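(* Put $$C=\frac{\sqrt{m-1}}{2^{1-(m-1)(1-\alpha)}-1}+1,\qquad R=\max\big\{\|z-p-\pi(z)v\|:z\in\{y_1,\dots,y_\ell\}\cup\{x_1,\dots,x_k\}\big\}.$$ Suppose $$\{\pi(x_1),\dots,\pi(x_k),\pi(y_1),\dots,\pi(y_\ell)\}\cap(t_1,t_2)=\emptyset$$ for some $t_1,t_2\in\mathbb{R}$ with $t_2=t_1+2CR+\sigma$, $\sigma>0$. If $$\{\pi(x_1),\dots,\pi(x_k)\}\cap(t_1-\sigma,t_1]\ne\emptyset\quad\text{and}\quad\{\pi(x_1),\dots,\pi(x_k)\}\cap[t_2,t_2+\sigma)\ne\emptyset,$$ then for any optimal assignment map $S\in Map[\ell,k]$ and interval $I=(-\infty,t_1]$ or $[t_2,\infty)$, we have $$\pi(y_j)\in I\iff\pi(x_{S(j)})\in I\qquad\text{for }j=1,\dots,\ell.$$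
   Context: $\alpha\in[0,1)$ is a parameter. $X\subset\mathbb{R}^m$ is compact and convex, $\|\cdot\|$ is the Euclidean norm, $\mathbf{x}=\{x_1,\dots,x_k\}\subset X$ is a finite set of $k$ points, $\mathbf{b}=\sum_{j=1}^\ell n_j\delta_{y_j}$ with $y_j\in X$, $n_j>0$, $\sum_j n_j=1$. Points $p,v\in\mathbb{R}^m$ with $\|v\|=1$ are fixed, and $\pi(z)=\langle z-p,v\rangle$ for $z\in\mathbb{R}^m$. For atomic measures $\mathbf{a},\mathbf{c}$ (finite sums of positively weighted Dirac masses) on $X$ of equal mass, a transport path from $\mathbf{a}$ to $\mathbf{c}$ is a weighted directed graph $G$ (without cycles) with finite vertex set $V(G)$ containing the atoms of $\mathbf{a}$ and $\mathbf{c}$, finite set $E(G)$ of directed edges which are line segments from $e^-$ to $e^+$, and weights $w:E(G)\to(0,\infty)$ such that for all $v'\in V(G)$, $\sum_{e^-=v'}w(e)=\sum_{e^+=v'}w(e)+\mathbf{a}(\{v'\})-\mathbf{c}(\{v'\})$. $\mathbf{M}_\alpha(G)=\sum_{e\in E(G)}w(e)^\alpha\,length(e)$ and $d_\alpha(\mathbf{a},\mathbf{c})$ is the minimum of $\mathbf{M}_\alpha(G)$ over all transport paths from $\mathbf{a}$ to $\mathbf{c}$ ($0$ for zero measures). $Map[\ell,k]$ is the set of functions $S:\{1,\dots,\ell\}\to\{1,\dots,k\}$. For such $S$, $\mathbf{a}_i=\big(\sum_{j\in S^{-1}(i)}n_j\big)\delta_{x_i}$, $\mathbf{b}_i=\sum_{j\in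 S^{-1}(i)}n_j\delta_{y_j}$, and $\mathbf{E}_\alpha(S;\mathbf{x},\mathbf{b})=\sum_{i=1}^kd_\alpha(\mathbf{a}_i,\mathbf{b}_i)$. $S$ is an optimal assignment map if it minimizes $\mathbf{E}_\alpha(\cdot\,;\mathbf{x},\mathbf{b})$ over $Map[\ell,k]$.
   Formalization: The formal theorem additionally assumes 1-(m-1)(1-α) > 0; when this exponent is 0 the constant C is undefined, and when it is negative C < 0 and the claim as stated has counterexamples. *)

theory Defs
  imports "HOL-Analysis.Analysis" "HOL-Library.Poly_Mapping" "HOL-Library.FuncSet"
begin

text \<open>
  An atomic measure (a finite sum of weighted Dirac masses) is represented by the finitely
  supported function giving the mass of each singleton: \<open>Poly_Mapping.single z r\<close> is the measure
  r times the Dirac mass at z, \<open>Poly_Mapping.lookup a z\<close> is a({z}), and \<open>Poly_Mapping.keys a\<close> is the set of atoms.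
\<close>

type_synonym 'a atomic_measure = "'a \<Rightarrow>\<^sub>0 real"

text \<open>A pair (u, z) in \<open>edges\<close> is the segment from u to z; \<open>weight\<close> only matters on \<open>edges\<close>.\<close>

record 'a weighted_digraph =
  verts :: "'a set"
  edges :: "('a \<times> 'a) set"
  weight :: "'a \<times> 'a \<Rightarrow> real"

text \<open>Acyclicity means that there is no directed cycle; in particular no edge is a loop.\<close>

definition transport_path ::
    "'a atomic_measure \<Rightarrow> 'a atomic_measure \<Rightarrow> 'a weighted_digraph \<Rightarrow> bool" where
  "transport_path a c G \<longleftrightarrow>
     finite (verts G) \<and> Poly_Mapping.keys a \<union> Poly_Mapping.keys c \<subseteq> verts G \<and>
     edges G \<subseteq> verts G \<times> verts G \<and> acyclic (edges G) \<and>
     (\<forall>e\<in>edges G. weight G e > 0) \<and>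
     (\<forall>u\<in>verts G.
        (\<Sum>e\<in>{e\<in>edges G. fst e = u}. weight G e) =
        (\<Sum>e\<in>{e\<in>edges G. snd e = u}. weight G e) + Poly_Mapping.lookup a u - Poly_Mapping.lookup c u)"

definition M_cost :: "real \<Rightarrow> ('a::metric_space) weighted_digraph \<Rightarrow> real" where
  "M_cost \<alpha> G = (\<Sum>e\<in>edges G. weight G e powr \<alpha> * dist (fst e) (snd e))"

text \<open>
  The minimum is written as an infimum. Between zero measures the empty graph is a transport
  path, so the value is 0 there.
\<close>

definition d_cost ::
    "real \<Rightarrow> ('a::metric_space) atomic_measure \<Rightarrow> 'a atomic_measure \<Rightarrow> real" where
  "d_cost \<alpha> a c = Inf {M_cost \<alpha> G | G. transport_path a c G}"

definition assignment_maps :: "nat \<Rightarrow> nat \<Rightarrow> (nat \<Rightarrow> nat) set" where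
  "assignment_maps l k = {1..l} \<rightarrow>\<^sub>E {1..k}"

definition source_part ::
    "nat \<Rightarrow> (nat \<Rightarrow> real) \<Rightarrow> (nat \<Rightarrow> 'a) \<Rightarrow> (nat \<Rightarrow> nat) \<Rightarrow> nat \<Rightarrow> 'a atomic_measure" where
  "source_part l n x S i = Poly_Mapping.single (x i) (\<Sum>j\<in>{j\<in>{1..l}. S j = i}. n j)"

definition target_part ::
    "nat \<Rightarrow> (nat \<Rightarrow> real) \<Rightarrow> (nat \<Rightarrow> 'a) \<Rightarrow> (nat \<Rightarrow> nat) \<Rightarrow> nat \<Rightarrow> 'a atomic_measure" where
  "target_part l n y S i = (\<Sum>j\<in>{j\<in>{1..l}. S j = i}. Poly_Mapping.single (y j) (n j))"

definition E_cost ::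
    "real \<Rightarrow> nat \<Rightarrow> nat \<Rightarrow> (nat \<Rightarrow> 'a::metric_space) \<Rightarrow> (nat \<Rightarrow> real) \<Rightarrow> (nat \<Rightarrow> 'a) \<Rightarrow>
     (nat \<Rightarrow> nat) \<Rightarrow> real" where
  "E_cost \<alpha> l k x n y S =
     (\<Sum>i=1..k. d_cost \<alpha> (source_part l n x S i) (target_part l n y S i))"

definition optimal_assignment ::
    "real \<Rightarrow> nat \<Rightarrow> nat \<Rightarrow> (nat \<Rightarrow> 'a::metric_space) \<Rightarrow> (nat \<Rightarrow> real) \<Rightarrow> (nat \<Rightarrow> 'a) \<Rightarrow>
     (nat \<Rightarrow> nat) \<Rightarrow> bool" where
  "optimal_assignment \<alpha> l k x n y S \<longleftrightarrow>
     S \<in> assignment_maps l k \<and>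
     (\<forall>T\<in>assignment_maps l k. E_cost \<alpha> l k x n y S \<le> E_cost \<alpha> l k x n y T)"

definition axis_coord :: "'a::real_inner \<Rightarrow> 'a \<Rightarrow> 'a \<Rightarrow> real" where
  "axis_coord p v z = (z - p) \<bullet> v"

end

theory Submission
  imports Defs
begin

text \<open>An optimal assignment with a target \<open>y j\<close> before the gap \<open>(t1, t2)\<close> served from a source
  beyond it is improved by handing all such targets of that source to a source \<open>x i'\<close> just before
  the gap. Being a concave function of the flow, the cost may be assumed to come from a tree, and such a
  tree is projected to the cylinder of radius \<open>R\<close> around the axis and cut at \<open>t1\<close>, \<open>t2\<close> and
  \<open>t2 - C R\<close>. Dyadic subdivision of an \<open>(m-1)\<close>-dimensional cube gathers a mass \<open>w\<close> spread over a cross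
  section of the cylinder at cost \<open>(C - 1) R w powr \<alpha>\<close>, or \<open>C R w powr \<alpha>\<close> if it has to end in an arbitrary
  point of that section. Hence paths from \<open>t2\<close> to below \<open>t2 - C R\<close> and back can be removed
  for free, and the stretch of length \<open>C R + \<sigma>\<close> that remains of the gap need not be crossed any more, while
  connecting \<open>x i'\<close> to the targets costs less than \<open>C R + \<sigma>\<close> times the power of their mass.\<close>

section \<open>Concavity of powers\<close>

text \<open>The obstacle is that branches serving the two sides of the gap are intertwined: a branch
  may dip below the gap and return, so deleting whatever leads to low targets could disconnect high
  ones. Hence the gap contains \<open>C R\<close> twice, once for repairing such returns and once
  for feeding the low targets from the new source. The constant comes from a cube of half side
  \<open>R\<close> around the cross section, in dimension \<open>d = m - 1\<close>. At depth
  \<open>k\<close> there are \<open>2^(d k)\<close> subcubes, their centers are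
  \<open>R sqrt d / 2^k\<close> away from those of their parents, and concavity bounds the sum of
  the powers of their masses by \<open>2^(d k (1 - \<alpha>))\<close> times the power of the total.
  With \<open>\<beta> = 1 - d (1 - \<alpha>)\<close> the costs add up to \<open>R sqrt d\<close>
  times the sum of \<open>2^(- \<beta> k)\<close> over \<open>k >= 1\<close>, which is
  \<open>R sqrt d / (2^\<beta> - 1)\<close>. The 1 added in \<open>C\<close> is the radius from the
  axis to a prescribed point. All estimates carry an arbitrary positive error. It is absorbed in the
  end because the new source lies strictly less than \<open>\<sigma>\<close> before the gap. The
  opposite misassignment reduces to this one by replacing \<open>v\<close> with
  \<open>- v\<close>.\<close>

lemma powr_tangent:
  fixes \<alpha> c t :: real
  assumes "0 \<le> \<alpha>" "\<alpha> \<le> 1" "c > 0" "t \<ge> 0"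
  shows "t powr \<alpha> \<le> c powr \<alpha> * (1 + \<alpha> * (t / c - 1))"
proof (cases "t = 0")
  case True
  then show ?thesis using assms by (simp add: algebra_simps)
next
  case False
  have "(t/c) powr \<alpha> * 1 powr (1 - \<alpha>) \<le> \<alpha> * (t/c) + (1 - \<alpha>) * 1"
    using assms False by (intro Youngs_inequality_0) auto
  then have "(t/c) powr \<alpha> \<le> 1 + \<alpha> * (t / c - 1)"
    by (simp add: algebra_simps)
  then have "c powr \<alpha> * (t/c) powr \<alpha> \<le> c powr \<alpha> * (1 + \<alpha> * (t / c - 1))"
    by (intro mult_left_mono) auto
  then show ?thesis using assms by (simp add: powr_divide)
qed

text \<open>The tangent at the weighted mean lies above the graph, and averaging the two tangent
  bounds makes the linear terms cancel.\<close>

lemma powr_concave: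
  fixes \<alpha> a b u w :: real
  assumes "0 \<le> \<alpha>" "\<alpha> \<le> 1" "a \<ge> 0" "b \<ge> 0" "u > 0" "w > 0" "u + w = 1"
  shows "u * a powr \<alpha> + w * b powr \<alpha> \<le> (u * a + w * b) powr \<alpha>"
proof (cases "u * a + w * b = 0")
  case True
  moreover have "u * a \<ge> 0" "w * b \<ge> 0" using assms by auto
  ultimately have "u * a = 0 \<and> w * b = 0" by linarith
  then have "a = 0" "b = 0" using assms by auto
  then show ?thesis by simp
next
  case False
  define c where "c = u * a + w * b"
  have "c \<ge> 0" using assms by (simp add: c_def)
  with False have c: "c > 0" by (simp add: c_def)
  have "u * a powr \<alpha> \<le> u * (c powr \<alpha> * (1 + \<alpha> * (a / c - 1)))"
    using assms powr_tangent[OF assms(1,2) c] by (intro mult_left_mono) auto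
  moreover have "w * b powr \<alpha> \<le> w * (c powr \<alpha> * (1 + \<alpha> * (b / c - 1)))"
    using assms powr_tangent[OF assms(1,2) c] by (intro mult_left_mono) auto
  moreover have "u * (c powr \<alpha> * (1 + \<alpha> * (a / c - 1))) + w * (c powr \<alpha> * (1 + \<alpha> * (b / c - 1)))
      = c powr \<alpha> * ((u + w) + \<alpha> * ((u * a + w * b) / c - (u + w)))"
    by (simp add: algebra_simps add_divide_distrib)
  moreover have "(u * a + w * b) / c = 1" using c by (simp add: c_def)
  ultimately show ?thesis using assms(7) by (simp add: c_def)
qed

lemma powr_subadditive:
  fixes \<alpha> a b :: real
  assumes "0 \<le> \<alpha>" "\<alpha> \<le> 1" "a \<ge> 0" "b \<ge> 0"
  shows "(a + b) powr \<alpha> \<le> a powr \<alpha> + b powr \<alpha>"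
proof (cases "a = 0 \<or> b = 0")
  case False
  then have ab: "a > 0" "b > 0" using assms by auto
  define s where "s = a + b"
  have s: "s > 0" "a / s \<le> 1" "b / s \<le> 1" "a / s > 0" "b / s > 0" using ab by (auto simp: s_def)
  have "a / s \<le> (a / s) powr \<alpha>" "b / s \<le> (b / s) powr \<alpha>"
    using powr_mono'[of \<alpha> 1 "a/s"] powr_mono'[of \<alpha> 1 "b/s"] s assms by auto
  moreover have "a / s + b / s = 1" using s by (simp add: s_def add_divide_distrib [symmetric])
  ultimately have "1 \<le> (a / s) powr \<alpha> + (b / s) powr \<alpha>" by linarith
  then have "s powr \<alpha> * 1 \<le> s powr \<alpha> * ((a / s) powr \<alpha> + (b / s) powr \<alpha>)"
    by (intro mult_left_mono) auto
  then show ?thesis using s ab by (simp add: powr_divide distrib_left s_def)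
qed auto

text \<open>Power mean inequality, from the tangent at the mean \<open>M / N\<close>. The factor
  \<open>card I powr (1 - \<alpha>)\<close> is the price of spreading a mass over
  \<open>card I\<close> branches.\<close>

lemma sum_powr_le_card:
  fixes f :: "'i \<Rightarrow> real"
  assumes "0 \<le> \<alpha>" "\<alpha> \<le> 1" "finite I" "\<And>i. i \<in> I \<Longrightarrow> f i \<ge> 0"
  shows "(\<Sum>i\<in>I. f i powr \<alpha>) \<le> real (card I) powr (1 - \<alpha>) * (\<Sum>i\<in>I. f i) powr \<alpha>"
proof (cases "(\<Sum>i\<in>I. f i) = 0")
  case True
  then have "\<forall>i\<in>I. f i = 0" using assms by (simp add: sum_nonneg_eq_0_iff)
  then show ?thesis by simp
next
  case False
  define M where "M = (\<Sum>i\<in>I. f i)"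
  define N where "N = real (card I)"
  have "M \<ge> 0" using assms by (simp add: M_def sum_nonneg)
  with False have M: "M > 0" by (simp add: M_def)
  have N: "N > 0" using False assms by (auto simp: N_def card_gt_0_iff)
  define c where "c = M / N"
  have c: "c > 0" using M N by (simp add: c_def)
  have "(\<Sum>i\<in>I. f i powr \<alpha>) \<le> (\<Sum>i\<in>I. c powr \<alpha> * (1 + \<alpha> * (f i / c - 1)))"
    using assms powr_tangent[OF assms(1,2) c] by (intro sum_mono) auto
  also have "\<dots> = c powr \<alpha> * (N + \<alpha> * (M / c - N))"
    by (simp add: sum_distrib_left [symmetric] sum.distrib sum_subtractf M_def N_def sum_divide_distrib)
  also have "M / c = N" using M N by (simp add: c_def)
  also have "c powr \<alpha> * (N + \<alpha> * (N - N)) = N powr (1 - \<alpha>) * M powr \<alpha>"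
    using M N by (simp add: c_def powr_divide powr_diff)
  finally show ?thesis by (simp add: M_def N_def)
qed

section \<open>Flows\<close>

text \<open>Net outflow at \<open>u\<close>. Written as one sum with signed indicators it is visibly
  linear in \<open>f\<close>, and loops drop out.\<close>

definition divergence :: "('a \<times> 'a) set \<Rightarrow> ('a \<times> 'a \<Rightarrow> real) \<Rightarrow> 'a \<Rightarrow> real" where
  "divergence E f u = (\<Sum>e\<in>E. f e * (of_bool (fst e = u) - of_bool (snd e = u)))"

text \<open>\<open>0 powr \<alpha>\<close> is 0 even for \<open>\<alpha> = 0\<close>, so an edge
  without flow is free and the edge set can be enlarged or reduced to the support at will.\<close>

definition flow_cost :: "real \<Rightarrow> ('a::metric_space \<times> 'a) set \<Rightarrow> ('a \<times> 'a \<Rightarrow> real) \<Rightarrow> real" where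
  "flow_cost \<alpha> E f = (\<Sum>e\<in>E. f e powr \<alpha> * dist (fst e) (snd e))"

lemma divergence_add: "divergence E (\<lambda>e. f e + g e) u = divergence E f u + divergence E g u"
  by (simp add: divergence_def distrib_right sum.distrib)

lemma divergence_scale: "divergence E (\<lambda>e. c * f e) u = c * divergence E f u"
  by (simp add: divergence_def sum_distrib_left mult.assoc)

lemma divergence_diff: "divergence E (\<lambda>e. f e - g e) u = divergence E f u - divergence E g u"
  by (simp add: divergence_def left_diff_distrib sum_subtractf)

lemma divergence_point:
  assumes "finite E" "e0 \<in> E"
  shows "divergence E (\<lambda>e. if e = e0 then c else 0) u
    = c * (of_bool (fst e0 = u) - of_bool (snd e0 = u))"
proof -
  have "divergence E (\<lambda>e. if e = e0 then c else 0) u =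
    (\<Sum>e\<in>E. if e = e0 then c * (of_bool (fst e0 = u) - of_bool (snd e0 = u)) else 0)"
    unfolding divergence_def by (rule sum.cong) auto
  then show ?thesis using assms by (simp add: sum.delta)
qed

lemma divergence_eq_out_minus_in:
  assumes "finite E"
  shows "divergence E f u = (\<Sum>e\<in>{e\<in>E. fst e = u}. f e) - (\<Sum>e\<in>{e\<in>E. snd e = u}. f e)"
proof -
  have "divergence E f u =
    (\<Sum>e\<in>E. (if fst e = u then f e else 0) - (if snd e = u then f e else 0))"
    unfolding divergence_def by (rule sum.cong) auto
  then show ?thesis using assms by (simp add: sum_subtractf sum.inter_filter)
qed

lemma divergence_superset:
  assumes "finite E'" "E \<subseteq> E'" "\<And>e. e \<in> E' - E \<Longrightarrow> f e = 0"
  shows "divergence E' f u = divergence E f u"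
  unfolding divergence_def using assms by (intro sum.mono_neutral_right) auto

lemma flow_cost_superset:
  assumes "finite E'" "E \<subseteq> E'" "\<And>e. e \<in> E' - E \<Longrightarrow> f e = 0"
  shows "flow_cost \<alpha> E' f = flow_cost \<alpha> E f"
  unfolding flow_cost_def using assms by (intro sum.mono_neutral_right) auto

lemma flow_cost_mono:
  assumes "0 \<le> \<alpha>" "\<And>e. e \<in> E \<Longrightarrow> 0 \<le> f e" "\<And>e. e \<in> E \<Longrightarrow> f e \<le> g e"
  shows "flow_cost \<alpha> E f \<le> flow_cost \<alpha> E g"
  unfolding flow_cost_def using assms by (intro sum_mono mult_right_mono powr_mono2) auto

lemma flow_cost_subadditive:
  assumes "0 \<le> \<alpha>" "\<alpha> \<le> 1" "\<And>e. e \<in> E \<Longrightarrow> 0 \<le> f e" "\<And>e. e \<in> E \<Longrightarrow> 0 \<le> g e"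
  shows "flow_cost \<alpha> E (\<lambda>e. f e + g e) \<le> flow_cost \<alpha> E f + flow_cost \<alpha> E g"
proof -
  have "flow_cost \<alpha> E (\<lambda>e. f e + g e)
    \<le> (\<Sum>e\<in>E. (f e powr \<alpha> + g e powr \<alpha>) * dist (fst e) (snd e))"
    unfolding flow_cost_def using assms by (intro sum_mono mult_right_mono powr_subadditive) auto
  then show ?thesis by (simp add: flow_cost_def distrib_right sum.distrib)
qed

lemma flow_cost_concave:
  assumes "0 \<le> \<alpha>" "\<alpha> \<le> 1" "\<And>e. e \<in> E \<Longrightarrow> 0 \<le> f e" "\<And>e. e \<in> E \<Longrightarrow> 0 \<le> g e"
    "u > 0" "w > 0" "u + w = 1"
  shows "u * flow_cost \<alpha> E f + w * flow_cost \<alpha> E g \<le> flow_cost \<alpha> E (\<lambda>e. u * f e + w * g e)"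
proof -
  have "(\<Sum>e\<in>E. (u * f e powr \<alpha> + w * g e powr \<alpha>) * dist (fst e) (snd e))
      \<le> flow_cost \<alpha> E (\<lambda>e. u * f e + w * g e)"
    unfolding flow_cost_def using assms by (intro sum_mono mult_right_mono powr_concave) auto
  then show ?thesis
    by (simp add: flow_cost_def distrib_right sum.distrib sum_distrib_left mult.assoc)
qed

text \<open>A ratio test: \<open>t\<close> is the smallest of the times \<open>f e / (- h e)\<close>
  at which a decreasing edge runs empty.\<close>

lemma maximal_step:
  fixes f h :: "'e \<Rightarrow> real"
  assumes "finite E" "\<And>e. e \<in> E \<Longrightarrow> f e > 0" "e1 \<in> E" "h e1 < 0"
  shows "\<exists>t>0. (\<forall>e\<in>E. f e + t * h e \<ge> 0) \<and> (\<exists>e0\<in>E. f e0 + t * h e0 = 0)"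
proof -
  define N where "N = {e\<in>E. h e < 0}"
  have N: "finite N" "N \<noteq> {}" using assms by (auto simp: N_def)
  define t where "t = Min ((\<lambda>e. f e / (- h e)) ` N)"
  have "t \<in> (\<lambda>e. f e / (- h e)) ` N" unfolding t_def using N by (intro Min_in) auto
  then obtain e0 where e0: "e0 \<in> N" "t = f e0 / (- h e0)" by auto
  have "t > 0" using e0 assms(2)[of e0] by (auto simp: N_def intro!: divide_pos_neg)
  moreover have "f e + t * h e \<ge> 0" if "e \<in> E" for e
  proof (cases "h e < 0")
    case True
    then have "t \<le> f e / (- h e)" unfolding t_def using N that by (intro Min_le) (auto simp: N_def)
    then have "t * (- h e) \<le> f e" using True by (simp only: pos_le_divide_eq[of "- h e"])
    then show ?thesis by simp
  next
    case False
    then show ?thesis using assms(2)[OF that] \<open>t > 0\<close> by (intro add_nonneg_nonneg) auto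
  qed
  moreover have "f e0 + t * h e0 = 0" using e0 by (auto simp: N_def)
  ultimately show ?thesis using e0(1) unfolding N_def by blast
qed

text \<open>The cost is concave along the line through \<open>f\<close> in the direction of a circulation \<open>h\<close>,
  so at one end of the segment of nonnegative flows it is at most the cost of \<open>f\<close>.\<close>

lemma cancel_circulation:
  assumes \<alpha>: "0 \<le> \<alpha>" "\<alpha> \<le> 1" and E: "finite E" "\<And>e. e \<in> E \<Longrightarrow> f e > 0"
    and h: "\<And>u. divergence E h u = 0" "e1 \<in> E" "h e1 \<noteq> 0"
  shows "\<exists>f'. (\<forall>e\<in>E. f' e \<ge> 0) \<and> (\<exists>e0\<in>E. f' e0 = 0) \<and>
    (\<forall>u. divergence E f' u = divergence E f u) \<and> flow_cost \<alpha> E f' \<le> flow_cost \<alpha> E f"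
proof -
  have "\<exists>g. (\<forall>u. divergence E g u = 0) \<and> g e1 < 0"
  proof (cases "h e1 < 0")
    case False
    then have "(- 1) * h e1 < 0" using h(3) by linarith
    moreover have "\<forall>u. divergence E (\<lambda>e. (- 1) * h e) u = 0" using h(1) by (simp only: divergence_scale) simp
    ultimately show ?thesis by (intro exI[of _ "\<lambda>e. (- 1) * h e"]) simp
  qed (use h in auto)
  then obtain g where g: "\<And>u. divergence E g u = 0" "g e1 < 0" by auto
  obtain t e0 where t: "t > 0" "\<forall>e\<in>E. f e + t * g e \<ge> 0" "e0 \<in> E" "f e0 + t * g e0 = 0"
    using maximal_step[of E f e1 g, OF E h(2) g(2)] by auto
  have div_t: "divergence E (\<lambda>e. f e + t * g e) u = divergence E f u" for u
    using g by (simp add: divergence_add divergence_scale)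
  show ?thesis
  proof (cases "\<exists>e2\<in>E. g e2 > 0")
    \<comment> \<open>No edge increases along \<open>g\<close>, so in the other direction the
      segment has no end; monotonicity of the cost suffices.\<close>
    case False
    then have "flow_cost \<alpha> E (\<lambda>e. f e + t * g e) \<le> flow_cost \<alpha> E f"
      using t \<alpha> by (intro flow_cost_mono) (auto simp: not_less mult_nonneg_nonpos)
    then show ?thesis using t div_t by (intro exI[of _ "\<lambda>e. f e + t * g e"]) auto
  next
    case True
    then obtain e2 where e2: "e2 \<in> E" "g e2 > 0" by auto
    then have "- g e2 < 0" by simp
    then obtain s e3 where s: "s > 0" "\<forall>e\<in>E. f e + s * (- g e) \<ge> 0" "e3 \<in> E"
        "f e3 + s * (- g e3) = 0"
      using maximal_step[of E f e2 "\<lambda>e. - g e", OF E e2(1)] by auto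
    define fp fm where "fp = (\<lambda>e. f e + t * g e)" and "fm = (\<lambda>e. f e + s * (- g e))"
    have div_s: "divergence E fm u = divergence E f u" for u
    proof -
      have "fm = (\<lambda>e. f e - s * g e)" by (simp add: fm_def)
      then show ?thesis using g(1) by (simp add: divergence_diff divergence_scale)
    qed
    \<comment> \<open>\<open>f\<close> is the convex combination of the end points \<open>fp\<close>
      and \<open>fm\<close> with weights \<open>c\<close> and \<open>d\<close>, so they cannot both
      cost more than \<open>f\<close>.\<close>
    define c where "c = s / (s + t)"
    define d where "d = t / (s + t)"
    have cd: "c > 0" "d > 0" "c + d = 1" using s(1) t(1)
      by (auto simp: c_def d_def add_divide_distrib[symmetric])
    have "c * fp e + d * fm e = f e" for e
    proof -
      have "c * fp e + d * fm e = (c + d) * f e + (c * t - d * s) * g e"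
        by (simp add: fp_def fm_def algebra_simps)
      also have "c * t - d * s = 0" by (simp add: c_def d_def)
      finally show ?thesis using cd by simp
    qed
    then have conv: "c * flow_cost \<alpha> E fp + d * flow_cost \<alpha> E fm \<le> flow_cost \<alpha> E f"
      using flow_cost_concave[OF \<alpha>, of E fp fm c d] t(2) s(2) cd by (auto simp: fp_def fm_def)
    have "flow_cost \<alpha> E fp \<le> flow_cost \<alpha> E f \<or> flow_cost \<alpha> E fm \<le> flow_cost \<alpha> E f"
    proof (rule ccontr)
      assume "\<not> ?thesis"
      then have "c * flow_cost \<alpha> E f + d * flow_cost \<alpha> E f < c * flow_cost \<alpha> E fp + d * flow_cost \<alpha> E fm"
        using cd by (intro add_strict_mono mult_strict_left_mono) auto
      then show False using conv cd by (simp add: distrib_right[symmetric])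
    qed
    then show ?thesis
    proof
      assume "flow_cost \<alpha> E fp \<le> flow_cost \<alpha> E f"
      then show ?thesis using t div_t by (intro exI[of _ fp]) (auto simp: fp_def)
    next
      assume "flow_cost \<alpha> E fm \<le> flow_cost \<alpha> E f"
      then show ?thesis using s div_s by (intro exI[of _ fm]) (auto simp: fm_def)
    qed
  qed
qed

text \<open>A walk becomes a flow by counting how often it uses each edge. The clause
  \<open>(snd e, u) \<in> E\<^sup>*\<close> records that every used edge leads on to
  \<open>u\<close>, which excludes edges into a sink other than \<open>u\<close>.\<close>

lemma unit_flow_along_path:
  assumes "(z, u) \<in> E\<^sup>*" "finite E"
  shows "\<exists>g. (\<forall>e. g e \<ge> 0) \<and> (\<forall>e. g e \<noteq> 0 \<longrightarrow> e \<in> E \<and> (snd e, u) \<in> E\<^sup>*) \<and>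
    (\<forall>w. divergence E g w = of_bool (w = z) - of_bool (w = u))"
  using assms(1)
proof (induction rule: rtrancl_induct)
  case base
  show ?case by (intro exI[of _ "\<lambda>_. 0"]) (simp add: divergence_def)
next
  case (step u u')
  then obtain g where g: "\<forall>e. g e \<ge> 0" "\<forall>e. g e \<noteq> 0 \<longrightarrow> e \<in> E \<and> (snd e, u) \<in> E\<^sup>*"
    "\<forall>w. divergence E g w = of_bool (w = z) - of_bool (w = u)" by auto
  have "divergence E (\<lambda>e. g e + (if e = (u, u') then 1 else 0)) w = of_bool (w = z) - of_bool (w = u')" for w
    using g(3) divergence_point[OF assms(2) step(2), of 1 w] by (auto simp: divergence_add)
  moreover have "e \<in> E \<and> (snd e, u') \<in> E\<^sup>*" if "g e + (if e = (u, u') then 1 else 0) \<noteq> 0" for e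
  proof (cases "e = (u, u')")
    case False
    then have "e \<in> E" "(snd e, u) \<in> E\<^sup>*" using that g(2)[rule_format, of e] by auto
    then show ?thesis using step(2) by (meson rtrancl.rtrancl_into_rtrancl)
  qed (use step(2) in auto)
  ultimately show ?case using g(1)
    by (intro exI[of _ "\<lambda>e. g e + (if e = (u, u') then 1 else 0)"]) (simp add: add_nonneg_nonneg)
qed

text \<open>\<open>transport_path\<close> forbids directed cycles, whereas superposed flows may
  contain them. The unit flow around a cycle is a circulation; cancelling it empties an edge, so the
  number of edges decreases.\<close>

lemma acyclic_flow:
  assumes \<alpha>: "0 \<le> \<alpha>" "\<alpha> \<le> 1" and "finite E" "\<And>e. e \<in> E \<Longrightarrow> f e \<ge> 0"
  shows "\<exists>E' f'. E' \<subseteq> E \<and> acyclic E' \<and> (\<forall>e\<in>E'. f' e > 0) \<and>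
    (\<forall>u. divergence E' f' u = divergence E f u) \<and> flow_cost \<alpha> E' f' \<le> flow_cost \<alpha> E f"
  using assms(3,4)
proof (induction "card E" arbitrary: E f rule: less_induct)
  case less
  define P where "P = {e\<in>E. f e > 0}"
  have P: "finite P" "P \<subseteq> E" "\<And>e. e \<in> E - P \<Longrightarrow> f e = 0"
    using less.prems by (auto simp: P_def not_less intro: antisym)
  have eqP: "divergence P f u = divergence E f u" "flow_cost \<alpha> P f = flow_cost \<alpha> E f" for u
    using P less.prems(1) divergence_superset[of E P f u] flow_cost_superset[of E P f \<alpha>] by simp_all
  have pos: "\<And>e. e \<in> P \<Longrightarrow> f e > 0" by (simp add: P_def)
  show ?case
  proof (cases "acyclic P")
    case True
    then show ?thesis using P(2) pos eqP by (intro exI[of _ P] exI[of _ f] conjI allI ballI) simp_all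
  next
    case False
    then obtain u where "(u, u) \<in> P\<^sup>+" by (auto simp: acyclic_def)
    then obtain z where z: "(u, z) \<in> P" "(z, u) \<in> P\<^sup>*" by (meson tranclD)
    obtain g where g: "\<forall>e. g e \<ge> 0" "\<forall>w. divergence P g w = of_bool (w = z) - of_bool (w = u)"
      using unit_flow_along_path[OF z(2) P(1)] by auto
    define h where "h = (\<lambda>e. g e + (if e = (u, z) then 1 else 0))"
    have div_h: "divergence P h w = 0" for w
      using g(2) divergence_point[OF P(1) z(1), of 1 w] by (auto simp: divergence_add h_def)
    have hne: "h (u, z) \<noteq> 0" using g(1) by (simp add: h_def add_nonneg_eq_0_iff)
    obtain f' e0 where f': "\<forall>e\<in>P. f' e \<ge> 0" "e0 \<in> P" "f' e0 = 0"
      "\<forall>u. divergence P f' u = divergence P f u" "flow_cost \<alpha> P f' \<le> flow_cost \<alpha> P f"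
      using cancel_circulation[where f = f, OF \<alpha> P(1) pos div_h z(1) hne] by blast
    define Q where "Q = P - {e0}"
    have Q: "finite Q" "Q \<subseteq> P" "\<And>e. e \<in> P - Q \<Longrightarrow> f' e = 0" using P f'(3) by (auto simp: Q_def)
    have eqQ: "divergence Q f' u = divergence P f' u" "flow_cost \<alpha> Q f' = flow_cost \<alpha> P f'" for u
      using Q P(1) divergence_superset[of P Q f' u] flow_cost_superset[of P Q f' \<alpha>] by simp_all
    have "card Q < card E"
      using f'(2) P less.prems(1) by (intro psubset_card_mono) (auto simp: Q_def)
    from less.hyps[OF this Q(1), of f'] obtain E' f'' where
      "E' \<subseteq> Q" "acyclic E'" "\<forall>e\<in>E'. f'' e > 0" "\<forall>u. divergence E' f'' u = divergence Q f' u"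
      "flow_cost \<alpha> E' f'' \<le> flow_cost \<alpha> Q f'" using f'(1) Q(2) by blast
    then show ?thesis using Q P eqQ eqP f' by (intro exI[of _ E'] exI[of _ f'']) auto
  qed
qed

section \<open>Irrigation\<close>

text \<open>Targets form a multiset of weighted points rather than a measure, so that those of
  different branches can be added and selected even where points coincide.\<close>

definition total_mass :: "('a \<times> real) multiset \<Rightarrow> real" where
  "total_mass C = sum_mset (image_mset snd C)"

definition mass_at :: "('a \<times> real) multiset \<Rightarrow> 'a \<Rightarrow> real" where
  "mass_at C u = sum_mset (image_mset (\<lambda>c. if fst c = u then snd c else 0) C)"

definition to_measure :: "('a \<times> real) multiset \<Rightarrow> 'a atomic_measure" where
  "to_measure C = sum_mset (image_mset (\<lambda>c. Poly_Mapping.single (fst c) (snd c)) C)"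

text \<open>\<open>irrig len A \<alpha> x C K\<close>: the weighted points \<open>C\<close> can be irrigated from \<open>x\<close> at cost at most \<open>K\<close> by a
  branching structure whose edges satisfy \<open>A\<close> and are charged the length \<open>len\<close>. Counting only
  the length inside a region lets one distribute the cost of a structure over several regions.\<close>

inductive irrig :: "('a \<Rightarrow> 'a \<Rightarrow> real) \<Rightarrow> ('a \<Rightarrow> 'a \<Rightarrow> bool) \<Rightarrow> real \<Rightarrow> 'a \<Rightarrow> ('a \<times> real) multiset \<Rightarrow> real \<Rightarrow> bool"
  for len A \<alpha> where
  empty: "irrig len A \<alpha> x {#} 0"
| leaf: "m \<ge> 0 \<Longrightarrow> irrig len A \<alpha> x {#(x, m)#} 0"
| edge: "irrig len A \<alpha> z C K \<Longrightarrow> A x z \<Longrightarrow> irrig len A \<alpha> x C (K + total_mass C powr \<alpha> * len x z)"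
| join: "irrig len A \<alpha> x C K \<Longrightarrow> irrig len A \<alpha> x C' K' \<Longrightarrow> irrig len A \<alpha> x (C + C') (K + K')"
| slack: "irrig len A \<alpha> x C K \<Longrightarrow> K \<le> K' \<Longrightarrow> irrig len A \<alpha> x C K'"

abbreviation irr :: "real \<Rightarrow> 'a::metric_space \<Rightarrow> ('a \<times> real) multiset \<Rightarrow> real \<Rightarrow> bool" where
  "irr \<equiv> irrig dist (\<lambda>_ _. True)"

lemma total_mass_simps [simp]:
  "total_mass {#} = 0" "total_mass (add_mset c C) = snd c + total_mass C"
  "total_mass (C + C') = total_mass C + total_mass C'"
  by (simp_all add: total_mass_def)

lemma mass_at_simps [simp]:
  "mass_at {#} u = 0" "mass_at (add_mset c C) u = (if fst c = u then snd c else 0) + mass_at C u"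
  "mass_at (C + C') u = mass_at C u + mass_at C' u"
  by (simp_all add: mass_at_def)

lemma to_measure_simps [simp]:
  "to_measure {#} = 0"
  "to_measure (add_mset c C) = Poly_Mapping.single (fst c) (snd c) + to_measure C"
  "to_measure (C + C') = to_measure C + to_measure C'"
  by (simp_all add: to_measure_def)

lemma lookup_to_measure: "Poly_Mapping.lookup (to_measure C) u = mass_at C u"
  by (induction C) (auto simp: lookup_add lookup_single when_def)

lemma total_mass_nonneg: "(\<And>c. c \<in># C \<Longrightarrow> snd c \<ge> 0) \<Longrightarrow> total_mass C \<ge> 0"
  by (induction C) auto

lemma mass_at_nonneg: "(\<And>c. c \<in># C \<Longrightarrow> snd c \<ge> 0) \<Longrightarrow> mass_at C u \<ge> 0"
  by (induction C) auto

lemma mass_at_eq_total_mass_filter: "mass_at C u = total_mass (filter_mset (\<lambda>c. fst c = u) C)"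
  by (induction C) auto

lemma mass_at_filter_ne: "mass_at (filter_mset (\<lambda>c. fst c \<noteq> u) C) v = (if v = u then 0 else mass_at C v)"
  by (induction C) auto

lemma total_mass_filter_le:
  "(\<And>c. c \<in># C \<Longrightarrow> snd c \<ge> 0) \<Longrightarrow> total_mass (filter_mset P C) \<le> total_mass C"
  by (induction C) (auto simp: add_increasing)

lemma irrig_weights: "irrig len A \<alpha> x C K \<Longrightarrow> c \<in># C \<Longrightarrow> snd c \<ge> 0"
  by (induction rule: irrig.induct) auto

lemma irrig_total_mass_nonneg: "irrig len A \<alpha> x C K \<Longrightarrow> total_mass C \<ge> 0"
  using irrig_weights total_mass_nonneg by metis

lemma irrig_cost_nonneg:
  assumes "irrig len A \<alpha> x C K" "\<And>x z. A x z \<Longrightarrow> len x z \<ge> 0"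
  shows "K \<ge> 0"
  using assms by (induction rule: irrig.induct) auto

lemma irrig_at_root:
  assumes "\<And>c. c \<in># C \<Longrightarrow> fst c = x \<and> snd c \<ge> 0"
  shows "irrig len A \<alpha> x C 0"
  using assms
proof (induction C)
  case (add c C)
  then have "irrig len A \<alpha> x {#(x, snd c)#} 0" by (intro irrig.leaf) auto
  moreover have "c = (x, snd c)" using add.prems by (metis prod.collapse union_single_eq_member)
  ultimately have "irrig len A \<alpha> x ({#c#} + C) (0 + 0)"
    using add by (intro irrig.join) auto
  then show ?case by simp
qed (auto intro: irrig.empty)

lemma irrig_sum:
  assumes "finite I" "\<And>i. i \<in> I \<Longrightarrow> irrig len A \<alpha> x (C i) (K i)"
  shows "irrig len A \<alpha> x (\<Sum>i\<in>I. C i) (\<Sum>i\<in>I. K i)"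
  using assms by (induction I rule: finite_induct) (auto intro: irrig.empty irrig.join)

text \<open>Joining every target directly to \<open>x\<close> shows that the infimum in
  \<open>d_cost\<close> is taken over a nonempty set.\<close>

lemma irr_star:
  assumes "\<And>c. c \<in># C \<Longrightarrow> snd c \<ge> 0"
  shows "\<exists>K. irr \<alpha> x C K"
  using assms
proof (induction C)
  case (add c C)
  then obtain K where K: "irr \<alpha> x C K" by auto
  have "irr \<alpha> (fst c) {#(fst c, snd c)#} 0" using add.prems by (intro irrig.leaf) auto
  from irrig.edge[OF this, of x] obtain K' where "irr \<alpha> x {#(fst c, snd c)#} K'" by auto
  from irrig.join[OF this K] show ?case by auto
qed (auto intro: irrig.empty)

text \<open>Replacing a leaf of mass \<open>w\<close> by a structure of the same mass leaves the
  mass through every earlier edge, hence its charge, unchanged.\<close>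

lemma irrig_graft:
  assumes "irrig len A \<alpha> x C K" "(z, w) \<in># C" "irrig len A \<alpha> z Q J" "total_mass Q = w"
  shows "irrig len A \<alpha> x (C - {#(z, w)#} + Q) (K + J)"
  using assms
proof (induction rule: irrig.induct)
  case (leaf m x)
  then show ?case by simp
next
  case (edge z' C K x)
  have "total_mass (C - {#(z, w)#} + Q) = total_mass C"
    using edge.prems by (auto dest!: multi_member_split)
  then show ?case
    using irrig.edge[OF edge.IH[OF edge.prems] edge.hyps(2)] by (simp add: algebra_simps)
next
  case (join x C K C' K')
  show ?case
  proof (cases "(z, w) \<in># C")
    case True
    then have "irrig len A \<alpha> x ((C - {#(z, w)#} + Q) + C') ((K + J) + K')"
      by (intro irrig.join[OF join.IH(1)[OF _ join.prems(2,3)] join.hyps(2)])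
    then show ?thesis using True by (auto simp: algebra_simps dest!: multi_member_split)
  next
    case False
    then have "(z, w) \<in># C'" using join.prems by simp
    then have "irrig len A \<alpha> x (C + (C' - {#(z, w)#} + Q)) (K + (K' + J))"
      by (intro irrig.join[OF join.hyps(1) join.IH(2)[OF _ join.prems(2,3)]])
    then show ?thesis using \<open>(z, w) \<in># C'\<close> by (auto simp: algebra_simps dest!: multi_member_split)
  qed
next
  case (slack x C K K')
  then show ?case by (meson irrig.slack add_right_mono)
qed auto

text \<open>If a vertex has two incoming edges, two paths from the root to it give a circulation that can
  be cancelled. Otherwise a sink is cut off together with its only incoming edge, and grafted
  back onto the irrigation of the remaining graph.\<close>

lemma irr_of_flow:
  assumes \<alpha>: "0 \<le> \<alpha>" "\<alpha> \<le> 1"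
    and "finite E" "acyclic E" "\<And>e. e \<in> E \<Longrightarrow> f e > 0" "\<And>c. c \<in># C \<Longrightarrow> snd c > 0"
    and "\<And>u. divergence E f u = (if u = x then m else 0) - mass_at C u"
  shows "irr \<alpha> x C (flow_cost \<alpha> E f)"
  using assms(3-)
proof (induction "card E" arbitrary: E f C rule: less_induct)
  case less
  note E = less.prems(1,2) and f = less.prems(3) and C = less.prems(4) and div = less.prems(5)
  have C0: "mass_at C u \<ge> 0" for u using C by (intro mass_at_nonneg) (auto simp: less_imp_le)
  \<comment> \<open>With outgoing but no incoming edges a vertex has positive divergence, which only
    the root can have.\<close>
  have in_edge: "\<exists>z'. (z', z) \<in> E" if "(z, u) \<in> E" "z \<noteq> x" for z u
  proof (rule ccontr)
    assume "\<not> ?thesis"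
    then have "{e\<in>E. snd e = z} = {}" by auto
    moreover have "(\<Sum>e\<in>{e\<in>E. fst e = z}. f e) > 0"
      using that E f by (intro sum_pos) auto
    ultimately have "divergence E f z > 0"
      using E by (simp only: divergence_eq_out_minus_in) simp
    then show False using div[of z] C0[of z] that by simp
  qed
  have reach: "(x, z) \<in> E\<^sup>*" if "(z, u) \<in> E" for z u
  proof -
    have "wf E" using E by (simp add: finite_acyclic_wf)
    then show ?thesis using that
    proof (induction z arbitrary: u rule: wf_induct_rule)
      case (less z)
      show ?case
      proof (cases "z = x")
        case False
        then obtain z' where "(z', z) \<in> E" using in_edge less.prems by blast
        then show ?thesis using less.IH by (meson rtrancl.rtrancl_into_rtrancl)
      qed simp
    qed
  qed
  show ?case
  proof (cases "E = {}")
    case True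
    have "fst c = x" if c: "c \<in># C" for c
    proof (rule ccontr)
      assume "fst c \<noteq> x"
      then have "mass_at C (fst c) = 0" using div[of "fst c"] True by (simp add: divergence_def)
      moreover obtain C' where C': "C = add_mset c C'" using multi_member_split[OF c] by auto
      moreover have "mass_at C' (fst c) \<ge> 0"
        using C C' by (intro mass_at_nonneg) (auto simp: less_imp_le)
      ultimately show False using C[OF c] by simp
    qed
    then show ?thesis using True C by (auto intro!: irrig_at_root simp: flow_cost_def less_imp_le)
  next
    case False
    have "wf (E\<inverse>)" using E by (simp add: finite_acyclic_wf_converse)
    moreover obtain a b where "(a, b) \<in> E" using False by auto
    ultimately obtain u where u: "u \<in> Range E" "\<And>y. (u, y) \<in> E \<Longrightarrow> y \<notin> Range E"
      by (metis wfE_min Range.intros converse_iff)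
    then have sink: "(u, y) \<notin> E" for y by blast
    obtain z where z: "(z, u) \<in> E" using u by auto
    have ux: "u \<noteq> x"
    proof
      assume "u = x"
      then have "(x, x) \<in> E\<^sup>+" using reach[OF z] z by (meson rtrancl_into_trancl1)
      then show False using E by (simp add: acyclic_def)
    qed
    have zu: "z \<noteq> u" using z sink by blast
    show ?thesis
    proof (cases "\<exists>z'. (z', u) \<in> E \<and> z' \<noteq> z")
      case True
      then obtain z' where z': "(z', u) \<in> E" "z' \<noteq> z" by auto
      obtain g where g: "\<forall>e. g e \<noteq> 0 \<longrightarrow> e \<in> E \<and> (snd e, z) \<in> E\<^sup>*"
        "\<forall>w. divergence E g w = of_bool (w = x) - of_bool (w = z)"
        using unit_flow_along_path[OF reach[OF z] E(1)] by auto
      obtain g' where g': "\<forall>e. g' e \<noteq> 0 \<longrightarrow> e \<in> E \<and> (snd e, z') \<in> E\<^sup>*"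
        "\<forall>w. divergence E g' w = of_bool (w = x) - of_bool (w = z')"
        using unit_flow_along_path[OF reach[OF z'(1)] E(1)] by auto
      have no_path: "(u, y) \<notin> E\<^sup>*" if "y \<noteq> u" for y
        using that sink by (metis converse_rtranclE)
      have "g (z, u) = 0" "g' (z, u) = 0"
        using g(1) g'(1) no_path zu z' sink by (metis snd_conv)+
      \<comment> \<open>The difference of two routes from \<open>x\<close> to \<open>u\<close>,
        through \<open>z\<close> and through \<open>z'\<close>. It is nonzero at
        \<open>(z, u)\<close> because the paths to \<open>z\<close> and \<open>z'\<close> cannot
        pass through the sink \<open>u\<close>.\<close>
      define h where "h = (\<lambda>e. (g e + (if e = (z, u) then 1 else 0)) - (g' e + (if e = (z', u) then 1 else 0)))"
      have div_h: "divergence E h w = 0" for w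
        using g(2) g'(2) divergence_point[OF E(1) z, of 1 w] divergence_point[OF E(1) z'(1), of 1 w]
        by (simp add: h_def divergence_diff divergence_add)
      have hne: "h (z, u) \<noteq> 0" using \<open>g (z, u) = 0\<close> \<open>g' (z, u) = 0\<close> z' by (simp add: h_def)
      obtain f' e0 where f': "\<forall>e\<in>E. f' e \<ge> 0" "e0 \<in> E" "f' e0 = 0"
        "\<forall>u. divergence E f' u = divergence E f u" "flow_cost \<alpha> E f' \<le> flow_cost \<alpha> E f"
        using cancel_circulation[where f = f, OF \<alpha> E(1) f div_h z hne] by blast
      define P where "P = {e\<in>E. f' e > 0}"
      have P: "finite P" "P \<subseteq> E" "\<And>e. e \<in> E - P \<Longrightarrow> f' e = 0"
        using E f'(1) by (auto simp: P_def not_less intro: antisym)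
      have pos: "f' e > 0" if "e \<in> P" for e using that by (simp add: P_def)
      have eqP: "divergence P f' u = divergence E f' u" "flow_cost \<alpha> P f' = flow_cost \<alpha> E f'" for u
        using P E(1) divergence_superset[of E P f' u] flow_cost_superset[of E P f' \<alpha>] by simp_all
      have "e0 \<notin> P" using f'(3) by (simp add: P_def)
      then have "card P < card E"
        using f'(2) P(2) E(1) by (intro psubset_card_mono) blast+
      moreover have "acyclic P" using E(2) P(2) by (rule acyclic_subset)
      moreover have "divergence P f' u = (if u = x then m else 0) - mass_at C u" for u
        using div f'(4) eqP(1) by simp
      ultimately have "irr \<alpha> x C (flow_cost \<alpha> P f')"
        using pos C by (intro less.hyps[OF _ P(1)])
      then show ?thesis by (rule irrig.slack) (simp add: eqP(2) f'(5))
    next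
      case False
      define w where "w = f (z, u)"
      have "e = (z, u)" if "e \<in> E" "snd e = u" for e
        using that False by (metis prod.collapse)
      then have "{e\<in>E. snd e = u} = {(z, u)}"
        using z snd_conv[of z u] by blast
      moreover have "{e\<in>E. fst e = u} = {}" using sink by auto
      ultimately have "divergence E f u = - w"
        using E(1) by (simp add: divergence_eq_out_minus_in w_def del: Collect_empty_eq)
      then have w: "mass_at C u = w" using div[of u] ux by simp
      have w0: "w > 0" using f[OF z] by (simp add: w_def)
      define D where "D = E - {(z, u)}"
      have D: "finite D" "acyclic D" "D \<subseteq> E" "\<And>e. e \<in> D \<Longrightarrow> f e > 0"
        using E f by (auto simp: D_def intro: acyclic_subset)
      have card_D: "card D < card E" unfolding D_def using E(1) z by (rule card_Diff1_less)
      define Q where "Q = filter_mset (\<lambda>c. fst c = u) C"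
      \<comment> \<open>The targets at \<open>u\<close> are merged into one target of mass
        \<open>w\<close> at \<open>z\<close>, which keeps the flow on the remaining edges
        balanced.\<close>
      define C' where "C' = filter_mset (\<lambda>c. fst c \<noteq> u) C + {#(z, w)#}"
      have ED: "E = insert (z, u) D" "(z, u) \<notin> D" using z by (auto simp: D_def)
      have "divergence D f v = (if v = x then m else 0) - mass_at C' v" for v
      proof -
        have "divergence E f v = w * (of_bool (z = v) - of_bool (u = v)) + divergence D f v"
          using ED D(1) by (simp add: divergence_def w_def)
        then show ?thesis using div[of v] w zu ux by (auto simp: C'_def mass_at_filter_ne)
      qed
      moreover have "snd c > 0" if "c \<in># C'" for c using that C[of c] w0 by (auto simp: C'_def)
      ultimately have "irr \<alpha> x C' (flow_cost \<alpha> D f)" using less.hyps[of D f C'] D card_D by simp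
      moreover have Q: "total_mass Q = w" using w by (simp add: Q_def mass_at_eq_total_mass_filter)
      moreover have "irr \<alpha> u Q 0" using C by (intro irrig_at_root) (auto simp: Q_def less_imp_le)
      then have "irr \<alpha> z Q (0 + total_mass Q powr \<alpha> * dist z u)" by (rule irrig.edge) simp
      ultimately have "irr \<alpha> x (C' - {#(z, w)#} + Q) (flow_cost \<alpha> D f + (0 + w powr \<alpha> * dist z u))"
        using irrig_graft[of dist _ \<alpha> x C' _ z w Q] by (simp add: C'_def)
      moreover have "C' - {#(z, w)#} + Q = C"
        using multiset_partition[of C "\<lambda>c. fst c = u"] by (simp add: C'_def Q_def add.commute)
      moreover have "flow_cost \<alpha> D f + (0 + w powr \<alpha> * dist z u) = flow_cost \<alpha> E f"
        using ED D(1) by (simp add: flow_cost_def w_def)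
      ultimately show ?thesis by simp
    qed
  qed
qed

section \<open>Passage between irrigations and transport paths\<close>

lemma flow_of_irr:
  assumes \<alpha>: "0 \<le> \<alpha>" "\<alpha> \<le> 1" and "irr \<alpha> x C K"
  shows "\<exists>E f. finite E \<and> (\<forall>e. f e \<ge> 0) \<and> (\<forall>e. e \<notin> E \<longrightarrow> f e = 0) \<and>
    (\<forall>u. divergence E f u = (if u = x then total_mass C else 0) - mass_at C u) \<and> flow_cost \<alpha> E f \<le> K"
  using assms(3)
proof (induction rule: irrig.induct)
  case (empty x)
  show ?case by (intro exI[of _ "{}"] exI[of _ "\<lambda>_. 0"]) (auto simp: divergence_def flow_cost_def)
next
  case (leaf m x)
  show ?case by (intro exI[of _ "{}"] exI[of _ "\<lambda>_. 0"]) (auto simp: divergence_def flow_cost_def)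
next
  case (edge z C K x)
  then obtain E f where E: "finite E" "\<forall>e. f e \<ge> 0" "\<forall>e. e \<notin> E \<longrightarrow> f e = 0" 
    "\<And>u. divergence E f u = (if u = z then total_mass C else 0) - mass_at C u" "flow_cost \<alpha> E f \<le> K"
    by auto
  define F where "F = insert (x, z) E"
  define g where "g = (\<lambda>e. if e = (x, z) then total_mass C else 0)"
  have F: "finite F" "E \<subseteq> F" "(x, z) \<in> F" using E(1) by (auto simp: F_def)
  have m: "total_mass C \<ge> 0" using edge.hyps(1) by (rule irrig_total_mass_nonneg)
  have "divergence F (\<lambda>e. f e + g e) u = (if u = x then total_mass C else 0) - mass_at C u" for u
    using divergence_superset[OF F(1,2), of f u] E(3,4)
      divergence_point[OF F(1,3), of "total_mass C" u] by (auto simp: divergence_add g_def)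
  moreover have "flow_cost \<alpha> F (\<lambda>e. f e + g e) \<le> flow_cost \<alpha> F f + flow_cost \<alpha> F g"
    using E m \<alpha> by (intro flow_cost_subadditive) (auto simp: g_def)
  moreover have "flow_cost \<alpha> F f = flow_cost \<alpha> E f"
    using E by (intro flow_cost_superset F) auto
  moreover have "flow_cost \<alpha> F g = flow_cost \<alpha> {(x, z)} g"
    using F by (intro flow_cost_superset) (auto simp: g_def)
  moreover have "flow_cost \<alpha> {(x, z)} g = total_mass C powr \<alpha> * dist x z"
    by (simp add: flow_cost_def g_def)
  moreover have "f e + g e = 0" if "e \<notin> F" for e
    using that E(3)[rule_format, of e] F by (auto simp: g_def)
  moreover have "f e + g e \<ge> 0" for e using E(2)[rule_format, of e] m by (simp add: g_def)
  ultimately show ?case using F E(5)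
    by (intro exI[of _ F] exI[of _ "\<lambda>e. f e + g e"]) simp
next
  case (join x C K C' K')
  then obtain E f where E: "finite E" "\<forall>e. f e \<ge> 0" "\<forall>e. e \<notin> E \<longrightarrow> f e = 0" 
    "\<And>u. divergence E f u = (if u = x then total_mass C else 0) - mass_at C u" "flow_cost \<alpha> E f \<le> K"
    by auto
  from join obtain E' f' where E': "finite E'" "\<forall>e. f' e \<ge> 0" "\<forall>e. e \<notin> E' \<longrightarrow> f' e = 0" 
    "\<And>u. divergence E' f' u = (if u = x then total_mass C' else 0) - mass_at C' u" "flow_cost \<alpha> E' f' \<le> K'"
    by auto
  have F: "finite (E \<union> E')" using E E' by auto
  have "divergence (E \<union> E') f u = divergence E f u" "divergence (E \<union> E') f' u = divergence E' f' u" for u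
    using divergence_superset[OF F, of E f u] divergence_superset[OF F, of E' f' u] E(3) E'(3) by blast+
  moreover have "flow_cost \<alpha> (E \<union> E') f = flow_cost \<alpha> E f" "flow_cost \<alpha> (E \<union> E') f' = flow_cost \<alpha> E' f'"
    using flow_cost_superset[OF F, of E f] flow_cost_superset[OF F, of E' f'] E(3) E'(3) by blast+
  moreover have "flow_cost \<alpha> (E \<union> E') (\<lambda>e. f e + f' e)
      \<le> flow_cost \<alpha> (E \<union> E') f + flow_cost \<alpha> (E \<union> E') f'"
    using E E' \<alpha> by (intro flow_cost_subadditive) auto
  ultimately show ?case using F E E'
    by (intro exI[of _ "E \<union> E'"] exI[of _ "\<lambda>e. f e + f' e"]) (auto simp: divergence_add)
next
  case (slack x C K K')
  then show ?case by (meson order_trans)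
qed

lemma transport_path_of_irr:
  assumes \<alpha>: "0 \<le> \<alpha>" "\<alpha> \<le> 1" and "irr \<alpha> x C K"
  shows "\<exists>G. transport_path (Poly_Mapping.single x (total_mass C)) (to_measure C) G \<and> M_cost \<alpha> G \<le> K"
proof -
  obtain E f where E: "finite E" "\<forall>e. f e \<ge> 0"
    "\<forall>u. divergence E f u = (if u = x then total_mass C else 0) - mass_at C u" "flow_cost \<alpha> E f \<le> K"
    using flow_of_irr[OF assms] by auto
  obtain E' f' where E': "E' \<subseteq> E" "acyclic E'" "\<forall>e\<in>E'. f' e > 0"
    "\<forall>u. divergence E' f' u = divergence E f u" "flow_cost \<alpha> E' f' \<le> flow_cost \<alpha> E f"
    using acyclic_flow[OF \<alpha> E(1), of f] E(2) by auto
  have fin: "finite E'" using E'(1) E(1) by (rule finite_subset)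
  define a where "a = Poly_Mapping.single x (total_mass C)"
  define G where "G = \<lparr>verts = Poly_Mapping.keys a \<union> Poly_Mapping.keys (to_measure C) \<union> (fst ` E' \<union> snd ` E'),
    edges = E', weight = f'\<rparr>"
  have "transport_path a (to_measure C) G"
    unfolding transport_path_def
  proof (intro conjI ballI)
    fix u
    have "divergence E' f' u = Poly_Mapping.lookup a u - Poly_Mapping.lookup (to_measure C) u"
      using E(3) E'(4) by (simp add: a_def lookup_single lookup_to_measure when_def)
    then show "(\<Sum>e\<in>{e\<in>edges G. fst e = u}. weight G e) =
        (\<Sum>e\<in>{e\<in>edges G. snd e = u}. weight G e) + Poly_Mapping.lookup a u - Poly_Mapping.lookup (to_measure C) u"
      using divergence_eq_out_minus_in[OF fin, of f' u] by (simp add: G_def)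
  qed (use fin E' in \<open>auto simp: G_def intro: rev_image_eqI\<close>)
  moreover have "M_cost \<alpha> G = flow_cost \<alpha> E' f'" by (simp add: M_cost_def G_def flow_cost_def)
  ultimately show ?thesis using E(4) E'(5) by (auto simp: a_def)
qed

lemma M_cost_nonneg: "M_cost \<alpha> G \<ge> 0"
  by (simp add: M_cost_def sum_nonneg)

lemma d_cost_le:
  assumes \<alpha>: "0 \<le> \<alpha>" "\<alpha> \<le> 1" and "irr \<alpha> x C K"
  shows "d_cost \<alpha> (Poly_Mapping.single x (total_mass C)) (to_measure C) \<le> K"
proof -
  obtain G where G: "transport_path (Poly_Mapping.single x (total_mass C)) (to_measure C) G" "M_cost \<alpha> G \<le> K"
    using transport_path_of_irr[OF assms] by auto
  have "bdd_below {M_cost \<alpha> G | G. transport_path (Poly_Mapping.single x (total_mass C)) (to_measure C) G}"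
    using M_cost_nonneg by (intro bdd_belowI[of _ 0]) auto
  then have "d_cost \<alpha> (Poly_Mapping.single x (total_mass C)) (to_measure C) \<le> M_cost \<alpha> G"
    unfolding d_cost_def using G(1) by (intro cInf_lower) auto
  then show ?thesis using G(2) by simp
qed

lemma irr_of_transport_path:
  assumes \<alpha>: "0 \<le> \<alpha>" "\<alpha> \<le> 1" and C: "\<And>c. c \<in># C \<Longrightarrow> snd c > 0"
    and G: "transport_path (Poly_Mapping.single x m) (to_measure C) G"
  shows "irr \<alpha> x C (M_cost \<alpha> G)"
proof -
  have fin: "finite (edges G)"
    using G unfolding transport_path_def by (meson finite_SigmaI finite_subset)
  have sub: "fst e \<in> verts G \<and> snd e \<in> verts G" if "e \<in> edges G" for e
    using that G unfolding transport_path_def by auto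
  have "divergence (edges G) (weight G) u = (if u = x then m else 0) - mass_at C u" for u
  proof (cases "u \<in> verts G")
    case True
    then have "(\<Sum>e\<in>{e\<in>edges G. fst e = u}. weight G e) =
        (\<Sum>e\<in>{e\<in>edges G. snd e = u}. weight G e) + Poly_Mapping.lookup (Poly_Mapping.single x m) u
          - Poly_Mapping.lookup (to_measure C) u"
      using G unfolding transport_path_def by blast
    then show ?thesis
      using fin by (auto simp: divergence_eq_out_minus_in lookup_single lookup_to_measure when_def)
  next
    case False
    then have "u \<notin> Poly_Mapping.keys (Poly_Mapping.single x m)" "u \<notin> Poly_Mapping.keys (to_measure C)"
      using G unfolding transport_path_def by blast+
    then have "Poly_Mapping.lookup (Poly_Mapping.single x m) u = 0" "Poly_Mapping.lookup (to_measure C) u = 0"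
      by (simp_all only: in_keys_iff not_not)
    moreover have "{e\<in>edges G. fst e = u} = {}" "{e\<in>edges G. snd e = u} = {}"
      using sub False by auto
    ultimately show ?thesis
      using fin by (auto simp: divergence_eq_out_minus_in lookup_single lookup_to_measure when_def
          simp del: Collect_empty_eq split: if_splits)
  qed
  then have "irr \<alpha> x C (flow_cost \<alpha> (edges G) (weight G))"
    using fin G C by (intro irr_of_flow[OF \<alpha>, where m = m]) (auto simp: transport_path_def)
  then show ?thesis by (simp add: flow_cost_def M_cost_def)
qed

lemma d_cost_approx:
  assumes \<alpha>: "0 \<le> \<alpha>" "\<alpha> \<le> 1" and C: "\<And>c. c \<in># C \<Longrightarrow> snd c > 0" and "\<epsilon> > 0"
  shows "\<exists>K < d_cost \<alpha> (Poly_Mapping.single x (total_mass C)) (to_measure C) + \<epsilon>. irr \<alpha> x C K"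
proof -
  let ?S = "{M_cost \<alpha> G | G. transport_path (Poly_Mapping.single x (total_mass C)) (to_measure C) G}"
  obtain K where "irr \<alpha> x C K" using irr_star[of C \<alpha> x] C less_imp_le by blast
  then have ne: "?S \<noteq> {}" using transport_path_of_irr[OF \<alpha>] by blast
  have "Inf ?S < d_cost \<alpha> (Poly_Mapping.single x (total_mass C)) (to_measure C) + \<epsilon>"
    using \<open>\<epsilon> > 0\<close> by (simp add: d_cost_def)
  from cInf_lessD[OF ne this] obtain K where "K \<in> ?S" "K < d_cost \<alpha> (Poly_Mapping.single x (total_mass C)) (to_measure C) + \<epsilon>"
    by blast
  then show ?thesis using irr_of_transport_path[OF \<alpha> C] by auto
qed

section \<open>Confining an irrigation to a convex set and localizing its cost\<close>

lemma irrig_project: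
  assumes "irr \<alpha> x C K" "\<And>c. c \<in># C \<Longrightarrow> fst c \<in> D"
    and f: "\<And>x. f x \<in> D" "\<And>x. x \<in> D \<Longrightarrow> f x = x" "\<And>x z. dist (f x) (f z) \<le> dist x z"
  shows "irrig dist (\<lambda>x z. x \<in> D \<and> z \<in> D) \<alpha> (f x) C K"
  using assms(1,2)
proof (induction rule: irrig.induct)
  case (edge z C K x)
  then have "irrig dist (\<lambda>x z. x \<in> D \<and> z \<in> D) \<alpha> (f z) C K" by auto
  then have "irrig dist (\<lambda>x z. x \<in> D \<and> z \<in> D) \<alpha> (f x) C (K + total_mass C powr \<alpha> * dist (f x) (f z))"
    by (rule irrig.edge) (use f in auto)
  then show ?case by (rule irrig.slack) (use f in \<open>auto intro!: mult_left_mono\<close>)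
qed (auto intro: irrig.intros simp: f(2))

text \<open>A point on the level belongs to both sides, so that a point inserted there fits with
  both of its neighbours.\<close>

definition same_side :: "('a \<Rightarrow> real) \<Rightarrow> real \<Rightarrow> 'a \<Rightarrow> 'a \<Rightarrow> bool" where
  "same_side g t x z \<longleftrightarrow> g x \<le> t \<and> g z \<le> t \<or> g x \<ge> t \<and> g z \<ge> t"

text \<open>By the intermediate value theorem an edge joining different sides meets the level
  \<open>t\<close>. Inserting a point of the segment does not change the cost, and the condition on
  \<open>A\<close> lets earlier requirements survive the insertion.\<close>

lemma irrig_subdivide:
  fixes g :: "'a::euclidean_space \<Rightarrow> real"
  assumes "irrig dist A \<alpha> x C K" and cont: "continuous_on UNIV g"
    and A: "\<And>x z q. A x z \<Longrightarrow> q \<in> closed_segment x z \<Longrightarrow> A x q \<and> A q z"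
  shows "irrig dist (\<lambda>x z. A x z \<and> same_side g t x z) \<alpha> x C K"
  using assms(1)
proof (induction rule: irrig.induct)
  case (edge z C K x)
  show ?case
  proof (cases "same_side g t x z")
    case True
    then show ?thesis using edge by (intro irrig.edge) auto
  next
    case False
    have "connected (g ` closed_segment x z)"
      using cont by (intro connected_continuous_image continuous_on_subset[OF cont]) auto
    moreover have "g x \<in> g ` closed_segment x z" "g z \<in> g ` closed_segment x z" by auto
    moreover have "g x \<le> t \<and> t \<le> g z \<or> g z \<le> t \<and> t \<le> g x"
      using False by (auto simp: same_side_def)
    ultimately have "t \<in> g ` closed_segment x z" by (meson connected_contains_Icc atLeastAtMost_iff subsetD)
    then obtain q where q: "q \<in> closed_segment x z" "g q = t" by auto
    have "A x q" "A q z" using A[OF edge.hyps(2) q(1)] by auto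
    moreover have "same_side g t x q" "same_side g t q z" using q(2) by (auto simp: same_side_def)
    ultimately have "irrig dist (\<lambda>x z. A x z \<and> same_side g t x z) \<alpha> x C
      ((K + total_mass C powr \<alpha> * dist q z) + total_mass C powr \<alpha> * dist x q)"
      by (intro irrig.edge[OF irrig.edge[OF edge.IH]] conjI)
    moreover have "dist x z = dist x q + dist q z"
      using q(1) by (simp add: between_mem_segment[symmetric] between)
    ultimately show ?thesis by (simp add: algebra_simps)
  qed
qed (auto intro: irrig.intros)

text \<open>Both half spaces of a level are convex, so subdividing at a further level keeps the
  edges on one side of the earlier ones.\<close>

lemma same_side_segment:
  assumes "same_side (axis_coord p v) t x z" "q \<in> closed_segment x z"
  shows "same_side (axis_coord p v) t x q \<and> same_side (axis_coord p v) t q z"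
proof -
  obtain u where u: "0 \<le> u" "u \<le> 1" "q = (1 - u) *\<^sub>R x + u *\<^sub>R z"
    using assms(2) by (auto simp: in_segment)
  have "axis_coord p v q = (1 - u) * axis_coord p v x + u * axis_coord p v z"
    unfolding u(3) by (simp add: axis_coord_def inner_diff_left inner_add_left algebra_simps)
  moreover have "(1 - u) * axis_coord p v x + u * axis_coord p v z \<le> t"
    if "axis_coord p v x \<le> t" "axis_coord p v z \<le> t"
    using convex_bound_le[OF that, of "1 - u" u] u by simp
  moreover have "(1 - u) * axis_coord p v x + u * axis_coord p v z \<ge> t"
    if "axis_coord p v x \<ge> t" "axis_coord p v z \<ge> t"
    using convex_bound_le[of "- axis_coord p v x" "- t" "- axis_coord p v z" "1 - u" u] that u by simp
  ultimately show ?thesis using assms(1) by (auto simp: same_side_def)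
qed

lemma irrig_subdivide_levels:
  fixes p v :: "'a::euclidean_space"
  assumes "irrig dist (\<lambda>x z. x \<in> D \<and> z \<in> D) \<alpha> x C K" "convex D" "finite T"
  shows "irrig dist (\<lambda>x z. x \<in> D \<and> z \<in> D \<and> (\<forall>t\<in>T. same_side (axis_coord p v) t x z)) \<alpha> x C K"
  using assms(3)
proof (induction T rule: finite_induct)
  case (insert t T)
  have "continuous_on UNIV (axis_coord p v)"
    unfolding axis_coord_def by (intro continuous_intros)
  from irrig_subdivide[OF insert.IH this, of t]
  have "irrig dist (\<lambda>x z. (x \<in> D \<and> z \<in> D \<and> (\<forall>t\<in>T. same_side (axis_coord p v) t x z)) \<and>
      same_side (axis_coord p v) t x z) \<alpha> x C K"
    using same_side_segment assms(2) by (meson closed_segment_subset subsetD)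
  moreover have "(\<lambda>x z. (x \<in> D \<and> z \<in> D \<and> (\<forall>t\<in>T. same_side (axis_coord p v) t x z)) \<and>
      same_side (axis_coord p v) t x z) =
    (\<lambda>x z. x \<in> D \<and> z \<in> D \<and> (\<forall>t\<in>insert t T. same_side (axis_coord p v) t x z))"
    by (auto simp: fun_eq_iff)
  ultimately show ?case by simp
qed (use assms in simp)

text \<open>One branching structure is charged twice, with \<open>len1\<close> and
  \<open>len2\<close> sharing the length of each edge. The two resulting bounds can then be treated
  by different arguments.\<close>

lemma irrig_split_length:
  assumes "irrig len A \<alpha> x C K" "\<And>x z. A x z \<Longrightarrow> len1 x z + len2 x z \<le> len x z"
  shows "\<exists>K1 K2. irrig len1 A \<alpha> x C K1 \<and> irrig len2 A \<alpha> x C K2 \<and> K1 + K2 \<le> K"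
  using assms(1)
proof (induction rule: irrig.induct)
  case (edge z C K x)
  then obtain K1 K2 where K: "irrig len1 A \<alpha> z C K1" "irrig len2 A \<alpha> z C K2" "K1 + K2 \<le> K" by auto
  have "total_mass C powr \<alpha> * (len1 x z + len2 x z) \<le> total_mass C powr \<alpha> * len x z"
    using assms(2)[OF edge.hyps(2)] by (intro mult_left_mono) auto
  then have "(K1 + total_mass C powr \<alpha> * len1 x z) + (K2 + total_mass C powr \<alpha> * len2 x z)
      \<le> K + total_mass C powr \<alpha> * len x z"
    using K(3) by (simp add: distrib_left)
  then show ?case using irrig.edge[OF K(1) edge.hyps(2)] irrig.edge[OF K(2) edge.hyps(2)] by blast
next
  case (join x C K C' K')
  then obtain K1 K2 K1' K2' where K: "irrig len1 A \<alpha> x C K1" "irrig len2 A \<alpha> x C K2" "K1 + K2 \<le> K"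
    "irrig len1 A \<alpha> x C' K1'" "irrig len2 A \<alpha> x C' K2'" "K1' + K2' \<le> K'" by auto
  then have "(K1 + K1') + (K2 + K2') \<le> K + K'" by simp
  then show ?case using irrig.join[OF K(1,4)] irrig.join[OF K(2,5)] by blast
next
  case (slack x C K K')
  then show ?case by (meson order_trans)
next
  case (empty x)
  show ?case using irrig.empty[of len1 A \<alpha> x] irrig.empty[of len2 A \<alpha> x] by force
next
  case (leaf m x)
  show ?case using irrig.leaf[OF leaf, of len1 A \<alpha> x] irrig.leaf[OF leaf, of len2 A \<alpha> x] by force
qed

section \<open>Gathering a forest at one point\<close>

text \<open>\<open>forest P \<alpha> C K b\<close>: irrigation of \<open>C\<close> from finitely many roots, all satisfying \<open>P\<close>; \<open>b\<close> is the sum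
  of the masses at the roots, each raised to the power \<open>\<alpha>\<close>.\<close>

inductive forest :: "('a::metric_space \<Rightarrow> bool) \<Rightarrow> real \<Rightarrow> ('a \<times> real) multiset \<Rightarrow> real \<Rightarrow> real \<Rightarrow> bool"
  for P \<alpha> where
  empty: "forest P \<alpha> {#} 0 0"
| add: "forest P \<alpha> C K b \<Longrightarrow> P q \<Longrightarrow> irr \<alpha> q C' K' \<Longrightarrow>
    forest P \<alpha> (C + C') (K + K') (b + total_mass C' powr \<alpha>)"

lemma forest_single: "P q \<Longrightarrow> irr \<alpha> q C K \<Longrightarrow> forest P \<alpha> C K (total_mass C powr \<alpha>)"
  using forest.add[OF forest.empty, of P q \<alpha> C K] by simp

lemma forest_union:
  assumes "forest P \<alpha> C' K' b'" "forest P \<alpha> C K b"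
  shows "forest P \<alpha> (C + C') (K + K') (b + b')"
  using assms
proof (induction rule: forest.induct)
  case (add C' K' b' q C'' K'')
  from forest.add[OF add.IH[OF add.prems] add.hyps(2,3)] show ?case by (simp add: add.assoc)
qed simp

lemma forest_weights: "forest P \<alpha> C K b \<Longrightarrow> c \<in># C \<Longrightarrow> snd c \<ge> 0"
  by (induction rule: forest.induct) (auto dest: irrig_weights)

lemma forest_total_mass_nonneg: "forest P \<alpha> C K b \<Longrightarrow> total_mass C \<ge> 0"
  using forest_weights total_mass_nonneg by metis

lemma forest_mono: "forest P \<alpha> C K b \<Longrightarrow> (\<And>q. P q \<Longrightarrow> Q q) \<Longrightarrow> forest Q \<alpha> C K b"
  by (induction rule: forest.induct) (auto intro: forest.intros)

lemma forest_star:
  assumes "forest P \<alpha> C K b" "\<And>q. P q \<Longrightarrow> dist c q \<le> r"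
  shows "irr \<alpha> c C (K + r * b)"
  using assms(1)
proof (induction rule: forest.induct)
  case (add C K b q C' K')
  have "irr \<alpha> c C' (K' + total_mass C' powr \<alpha> * dist c q)"
    using add.hyps(3) by (rule irrig.edge) simp
  then have "irr \<alpha> c C' (K' + total_mass C' powr \<alpha> * r)"
    by (rule irrig.slack) (use assms(2)[OF add.hyps(2)] in \<open>auto intro!: mult_left_mono\<close>)
  from irrig.join[OF add.IH this] show ?case by (simp add: algebra_simps)
qed (simp add: irrig.empty)

text \<open>Each tree goes as a whole to the class \<open>s q\<close> of its root, so costs and
  masses at the roots are merely distributed.\<close>

lemma forest_split:
  assumes "forest P \<alpha> C K b" "finite I" "\<And>q. P q \<Longrightarrow> s q \<in> I"
  shows "\<exists>C' K' b'. (\<forall>i\<in>I. forest (\<lambda>q. P q \<and> s q = i) \<alpha> (C' i) (K' i) (b' i)) \<and>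
    C = (\<Sum>i\<in>I. C' i) \<and> K = (\<Sum>i\<in>I. K' i) \<and> b = (\<Sum>i\<in>I. b' i)"
  using assms(1)
proof (induction rule: forest.induct)
  case empty
  show ?case by (intro exI[of _ "\<lambda>_. {#}"] exI[of _ "\<lambda>_. 0"]) (auto intro: forest.empty)
next
  case (add C K b q C0 K0)
  then obtain C' K' b' where IH: "\<forall>i\<in>I. forest (\<lambda>q. P q \<and> s q = i) \<alpha> (C' i) (K' i) (b' i)"
    "C = (\<Sum>i\<in>I. C' i)" "K = (\<Sum>i\<in>I. K' i)" "b = (\<Sum>i\<in>I. b' i)" by auto
  have sq: "s q \<in> I" using assms(3) add.hyps(2) by auto
  show ?case
  proof (intro exI conjI ballI)
    fix i assume "i \<in> I"
    then show "forest (\<lambda>q. P q \<and> s q = i) \<alpha> (C' i + (if i = s q then C0 else {#}))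
        (K' i + (if i = s q then K0 else 0)) (b' i + (if i = s q then total_mass C0 powr \<alpha> else 0))"
      using IH(1) add.hyps(2,3) by (auto intro: forest.add)
  next
    have "(\<Sum>i\<in>I. if i = s q then C0 else {#}) = C0"
      using sum.delta[OF assms(2), of "s q" "\<lambda>_. C0"] sq by simp
    then show "C + C0 = (\<Sum>i\<in>I. C' i + (if i = s q then C0 else {#}))"
      using IH(2) by (simp add: sum.distrib)
  qed (use IH sq assms(2) in \<open>auto simp: sum.distrib\<close>)
qed

lemma total_mass_sum: "total_mass (\<Sum>i\<in>I. C i) = (\<Sum>i\<in>I. total_mass (C i))"
  by (induction I rule: infinite_finite_induct) auto

text \<open>\<open>r\<close> is half the side length. For orthonormal \<open>B\<close> this is the
  cube about \<open>c\<close> in the affine space \<open>c + span B\<close> with sides along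
  \<open>B\<close>.\<close>

definition cube :: "'a::euclidean_space set \<Rightarrow> 'a \<Rightarrow> real \<Rightarrow> 'a \<Rightarrow> bool" where
  "cube B c r q \<longleftrightarrow> q - c \<in> span B \<and> (\<forall>b\<in>B. \<bar>(q - c) \<bullet> b\<bar> \<le> r)"

text \<open>By Parseval's identity; the bound is half the diagonal of a cube of half side
  \<open>r\<close>.\<close>

lemma norm_orthonormal_span_le:
  fixes w :: "'a::euclidean_space"
  assumes B: "finite B" "pairwise orthogonal B" "\<And>b. b \<in> B \<Longrightarrow> norm b = 1"
    and w: "w \<in> span B" "\<And>b. b \<in> B \<Longrightarrow> \<bar>w \<bullet> b\<bar> \<le> r" and "r \<ge> 0"
  shows "norm w \<le> r * sqrt (real (card B))"
proof -
  have "w \<bullet> w = (\<Sum>b\<in>B. (w \<bullet> b) *\<^sub>R b) \<bullet> w"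
    using orthonormal_basis_expand[OF B(2,3) w(1) B(1)] by simp
  also have "\<dots> = (\<Sum>b\<in>B. (w \<bullet> b)\<^sup>2)"
    by (simp add: inner_commute[of _ w] inner_sum_right power2_eq_square)
  also have "\<dots> \<le> (\<Sum>b\<in>B. r\<^sup>2)"
  proof (rule sum_mono)
    fix b assume "b \<in> B"
    from power_mono[OF w(2)[OF this], of 2] show "(w \<bullet> b)\<^sup>2 \<le> r\<^sup>2" by simp
  qed
  finally have "(norm w)\<^sup>2 \<le> (r * sqrt (real (card B)))\<^sup>2"
    by (simp add: power2_norm_eq_inner power_mult_distrib mult.commute)
  then show ?thesis by (rule power2_le_imp_le) (simp add: \<open>r \<ge> 0\<close>)
qed

text \<open>Dyadic subdivision: the cube is cut into \<open>2^d\<close> cubes of half the size, and each of their centers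
  is connected to the center of the cube. By concavity one such step multiplies the sum of the
  costs by at most \<open>2 powr -\<beta>\<close>, so that the costs of all steps add up to a geometric series.\<close>

lemma forest_gather_dyadic:
  fixes B :: "'a::euclidean_space set"
  assumes \<alpha>: "0 \<le> \<alpha>" "\<alpha> \<le> 1"
    and B: "finite B" "pairwise orthogonal B" "\<And>b. b \<in> B \<Longrightarrow> norm b = 1"
    and \<beta>: "\<beta> = 1 - real (card B) * (1 - \<alpha>)" "\<beta> > 0"
    and "forest (cube B c r) \<alpha> C K b" "r \<ge> 0"
  shows "irr \<alpha> c C (K + r * sqrt (real (card B)) * (total_mass C powr \<alpha> / (2 powr \<beta> - 1) + b / 2 ^ N))"
  using assms(8-)
proof (induction N arbitrary: c r C K b)
  case 0
  have "(2::real) powr \<beta> > 1" using \<beta>(2) by simp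
  then have T0: "total_mass C powr \<alpha> / (2 powr \<beta> - 1) \<ge> 0" by simp
  have "irr \<alpha> c C (K + r * sqrt (real (card B)) * b)"
  proof (rule forest_star[OF 0(1)])
    fix q assume "cube B c r q"
    then have "norm (q - c) \<le> r * sqrt (real (card B))"
      using 0(2) by (intro norm_orthonormal_span_le B) (auto simp: cube_def)
    then show "dist c q \<le> r * sqrt (real (card B))" by (simp add: dist_norm norm_minus_commute)
  qed
  moreover have "r * sqrt (real (card B)) * b \<le>
    r * sqrt (real (card B)) * (total_mass C powr \<alpha> / (2 powr \<beta> - 1) + b / 2 ^ 0)"
    using 0(2) T0 by (intro mult_left_mono) auto
  ultimately show ?case by (auto intro: irrig.slack)
next
  case (Suc N)
  define d where "d = sqrt (real (card B))"
  \<comment> \<open>\<open>T\<close> is the fixed point of one subdivision step,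
    \<open>2 powr (- \<beta>) * (T + 1) = T\<close>, where the 1 stands for the edge to the center
    of a subcube.\<close>
  define T where "T = 1 / (2 powr \<beta> - 1)"
  have T: "T > 0" using \<beta>(2) by (simp add: T_def)
  \<comment> \<open>Subcubes are indexed by the set of directions in \<open>B\<close> with
    nonnegative coordinate. Counting 0 as positive puts each root into exactly one class.\<close>
  define sgn where "sgn = (\<lambda>(s :: 'a set) b. if b \<in> s then (1::real) else -1)"
  define ctr where "ctr = (\<lambda>s. c + (\<Sum>b\<in>B. (r / 2 * sgn s b) *\<^sub>R b))"
  define s where "s = (\<lambda>q. {b\<in>B. (q - c) \<bullet> b \<ge> 0})"
  have orth: "b \<bullet> b' = (if b = b' then 1 else 0)" if "b \<in> B" "b' \<in> B" for b b'
    using that B by (auto simp: pairwise_def orthogonal_def norm_eq_1)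
  have ctr_inner: "(ctr t - c) \<bullet> b = r / 2 * sgn t b" if "b \<in> B" for t b
  proof -
    have "(ctr t - c) \<bullet> b = (\<Sum>b'\<in>B. (r / 2 * sgn t b') * (b' \<bullet> b))" by (simp add: ctr_def inner_sum_left)
    also have "\<dots> = (\<Sum>b'\<in>B. if b' = b then r / 2 * sgn t b else 0)"
      using that orth by (intro sum.cong) auto
    finally show ?thesis using that B(1) by simp
  qed
  have ctr_span: "ctr t - c \<in> span B" for t
  proof -
    have "(\<Sum>b\<in>B. (r / 2 * sgn t b) *\<^sub>R b) \<in> span B"
      by (intro span_sum span_scale span_base)
    then show ?thesis by (simp add: ctr_def)
  qed
  have ctr_dist: "dist c (ctr t) \<le> r / 2 * d" for t
  proof -
    have "norm (ctr t - c) \<le> r / 2 * sqrt (real (card B))"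
      using ctr_span Suc.prems(2)
      by (intro norm_orthonormal_span_le B) (auto simp: ctr_inner sgn_def abs_mult)
    then show ?thesis by (simp add: dist_norm norm_minus_commute d_def)
  qed
  have child: "cube B (ctr (s q)) (r / 2) q" if "cube B c r q" for q
    unfolding cube_def
  proof (intro conjI ballI)
    have "(q - c) - (ctr (s q) - c) \<in> span B"
      using that unfolding cube_def by (intro span_diff[OF _ ctr_span]) simp
    then show "q - ctr (s q) \<in> span B" by simp
  next
    fix b assume b: "b \<in> B"
    have "(q - ctr (s q)) \<bullet> b = (q - c) \<bullet> b - (ctr (s q) - c) \<bullet> b" by (simp add: inner_diff_left)
    also have "\<dots> = (q - c) \<bullet> b - r / 2 * (if (q - c) \<bullet> b \<ge> 0 then 1 else -1)"
      using ctr_inner[OF b] b by (simp add: sgn_def s_def)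
    finally show "\<bar>(q - ctr (s q)) \<bullet> b\<bar> \<le> r / 2"
      using that[unfolded cube_def, THEN conjunct2, rule_format, OF b]
      unfolding abs_le_iff by (simp split: if_splits)
  qed
  obtain C' K' b' where F: "\<forall>i\<in>Pow B. forest (\<lambda>q. cube B c r q \<and> s q = i) \<alpha> (C' i) (K' i) (b' i)"
    "C = (\<Sum>i\<in>Pow B. C' i)" "K = (\<Sum>i\<in>Pow B. K' i)" "b = (\<Sum>i\<in>Pow B. b' i)"
    using forest_split[OF Suc.prems(1), of "Pow B" s] B(1) by (auto simp: s_def)
  have m0: "total_mass (C' i) \<ge> 0" if "i \<in> Pow B" for i
    using F(1) that forest_total_mass_nonneg by blast
  define K'' where "K'' i = K' i + r / 2 * d * (total_mass (C' i) powr \<alpha> * (T + 1) + b' i / 2 ^ N)" for i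
  have "irr \<alpha> c (C' i) (K'' i)" if i: "i \<in> Pow B" for i
  proof -
    have "forest (cube B (ctr i) (r / 2)) \<alpha> (C' i) (K' i) (b' i)"
      using F(1)[rule_format, OF i] by (rule forest_mono) (use child in auto)
    then have "irr \<alpha> (ctr i) (C' i) (K' i + r / 2 * sqrt (real (card B)) *
        (total_mass (C' i) powr \<alpha> / (2 powr \<beta> - 1) + b' i / 2 ^ N))"
      using Suc.prems(2) by (intro Suc.IH) auto
    from irrig.edge[OF this, of c] have "irr \<alpha> c (C' i) (K' i + r / 2 * d *
        (total_mass (C' i) powr \<alpha> * T + b' i / 2 ^ N) + total_mass (C' i) powr \<alpha> * dist c (ctr i))"
      by (simp add: d_def T_def)
    moreover have "total_mass (C' i) powr \<alpha> * dist c (ctr i) \<le> total_mass (C' i) powr \<alpha> * (r / 2 * d)"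
      using ctr_dist by (intro mult_left_mono) auto
    ultimately show ?thesis unfolding K''_def by (elim irrig.slack) (simp add: algebra_simps)
  qed
  then have "irr \<alpha> c C (\<Sum>i\<in>Pow B. K'' i)"
    unfolding F(2) using B(1) by (intro irrig_sum) auto
  moreover have "(\<Sum>i\<in>Pow B. K'' i) \<le> K + r * d * (total_mass C powr \<alpha> * T + b / 2 ^ Suc N)"
  proof -
    have "(\<Sum>i\<in>Pow B. total_mass (C' i) powr \<alpha>)
        \<le> real (card (Pow B)) powr (1 - \<alpha>) * (\<Sum>i\<in>Pow B. total_mass (C' i)) powr \<alpha>"
      using B(1) m0 by (intro sum_powr_le_card \<alpha>) auto
    \<comment> \<open>The price of spreading the mass over \<open>2 ^ card B\<close> subcubes; its
      leading 2 is compensated by the halved size \<open>r / 2\<close>.\<close>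
    also have "real (card (Pow B)) powr (1 - \<alpha>) = 2 * 2 powr (- \<beta>)"
    proof -
      have "real (card (Pow B)) = 2 powr real (card B)" by (simp add: card_Pow B(1) powr_realpow)
      then have "real (card (Pow B)) powr (1 - \<alpha>) = 2 powr (1 + - \<beta>)"
        by (simp add: powr_powr \<beta>(1))
      then show ?thesis by (simp add: powr_diff powr_minus divide_inverse)
    qed
    also have "(\<Sum>i\<in>Pow B. total_mass (C' i)) = total_mass C" by (simp add: F(2) total_mass_sum)
    finally have "(\<Sum>i\<in>Pow B. total_mass (C' i) powr \<alpha>) * (T + 1)
        \<le> 2 * 2 powr (- \<beta>) * total_mass C powr \<alpha> * (T + 1)"
      using T by (intro mult_right_mono) auto
    also have "\<dots> = 2 * total_mass C powr \<alpha> * (2 powr (- \<beta>) * (T + 1))" by (simp add: algebra_simps)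
    also have "2 powr (- \<beta>) * (T + 1) = T"
    proof -
      define u where "u = (2::real) powr \<beta>"
      have "u > 1" using \<beta>(2) by (simp add: u_def)
      then have "1 / u * (1 / (u - 1) + 1) = 1 / (u - 1)" by (simp add: field_simps)
      then show ?thesis by (simp add: T_def powr_minus u_def divide_inverse)
    qed
    finally have "r / 2 * d * ((\<Sum>i\<in>Pow B. total_mass (C' i) powr \<alpha>) * (T + 1) + b / 2 ^ N)
        \<le> r / 2 * d * (2 * total_mass C powr \<alpha> * T + b / 2 ^ N)"
      using Suc.prems(2) by (intro mult_left_mono add_right_mono) (auto simp: d_def)
    moreover have "(\<Sum>i\<in>Pow B. K'' i)
        = K + r / 2 * d * ((\<Sum>i\<in>Pow B. total_mass (C' i) powr \<alpha>) * (T + 1) + b / 2 ^ N)"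
      by (simp add: K''_def sum.distrib F(3,4)
          flip: sum_distrib_left sum_distrib_right sum_divide_distrib)
    moreover have "r / 2 * d * (2 * total_mass C powr \<alpha> * T + b / 2 ^ N)
        = r * d * (total_mass C powr \<alpha> * T + b / 2 ^ Suc N)"
      by (simp add: field_simps)
    ultimately show ?thesis by linarith
  qed
  ultimately show ?case by (auto simp: d_def T_def elim!: irrig.slack)
qed

text \<open>\<open>b\<close> is fixed while \<open>N\<close> grows, so the direct connections at the
  finest scale become negligible and are absorbed by \<open>\<epsilon>\<close>.\<close>

lemma forest_gather:
  fixes B :: "'a::euclidean_space set"
  assumes \<alpha>: "0 \<le> \<alpha>" "\<alpha> \<le> 1"
    and B: "finite B" "pairwise orthogonal B" "\<And>b. b \<in> B \<Longrightarrow> norm b = 1"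
    and \<beta>: "\<beta> = 1 - real (card B) * (1 - \<alpha>)" "\<beta> > 0"
    and F: "forest (cube B c r) \<alpha> C K b" and r: "r \<ge> 0" and "\<epsilon> > 0"
  shows "irr \<alpha> c C (K + sqrt (real (card B)) / (2 powr \<beta> - 1) * r * total_mass C powr \<alpha> + \<epsilon>)"
proof -
  have "(\<lambda>N. r * sqrt (real (card B)) * b * (1/2) ^ N) \<longlonglongrightarrow> r * sqrt (real (card B)) * b * 0"
    by (intro tendsto_intros LIMSEQ_power_zero) auto
  then have "\<forall>\<^sub>F N in sequentially. r * sqrt (real (card B)) * b * (1/2) ^ N < \<epsilon>"
    using \<open>\<epsilon> > 0\<close> by (intro order_tendstoD(2)) auto
  then obtain N where "r * sqrt (real (card B)) * b * (1/2) ^ N < \<epsilon>"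
    by (auto simp: eventually_sequentially)
  moreover have "irr \<alpha> c C
      (K + r * sqrt (real (card B)) * (total_mass C powr \<alpha> / (2 powr \<beta> - 1) + b / 2 ^ N))"
    by (rule forest_gather_dyadic[OF \<alpha> B(1,2) _ \<beta> F r]) (rule B(3))
  ultimately show ?thesis
    by (elim irrig.slack) (simp add: distrib_left power_one_over mult.commute mult.left_commute)
qed

section \<open>Cutting an irrigation at a hyperplane\<close>

lemma forest_cost_nonneg: "forest P \<alpha> C K b \<Longrightarrow> K \<ge> 0"
  by (induction rule: forest.induct) (auto dest: irrig_cost_nonneg)

lemma powr_mass_subadditive_mult:
  assumes "0 \<le> \<alpha>" "\<alpha> \<le> 1" "total_mass C \<ge> 0" "total_mass C' \<ge> 0" "(s::real) \<ge> 0"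
  shows "total_mass (C + C') powr \<alpha> * s \<le> total_mass C powr \<alpha> * s + total_mass C' powr \<alpha> * s"
  using mult_right_mono[OF powr_subadditive[OF assms(1-4)] assms(5)] by (simp add: distrib_right)

text \<open>The part of \<open>C\<close> below level \<open>s1\<close> is irrigated by what remains of the structure after
  the last crossing of that level.\<close>

lemma irrig_cut:
  fixes g :: "'a::metric_space \<Rightarrow> real" and s1 s2 :: real
  defines "sav \<equiv> \<lambda>u. max 0 (min (g u) s2 - s1)"
  defines "low \<equiv> filter_mset (\<lambda>c. g (fst c) \<le> s1)"
  assumes \<alpha>: "0 \<le> \<alpha>" "\<alpha> \<le> 1" and "irrig len A \<alpha> x C K" "x \<in> D"
    and A: "\<And>x z. A x z \<Longrightarrow> z \<in> D" "\<And>x z. A x z \<Longrightarrow> same_side g s1 x z" "\<And>x z. A x z \<Longrightarrow> len x z \<ge> 0"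
      "\<And>x z. A x z \<Longrightarrow> g x \<le> s1 \<Longrightarrow> g z \<le> s1 \<Longrightarrow> dist x z \<le> len x z"
      "\<And>x z. A x z \<Longrightarrow> sav x \<le> sav z + len x z"
  shows "\<exists>C0 C1 K0 K1 b. low C = C0 + C1 \<and> irr \<alpha> x C0 K0 \<and> forest (\<lambda>q. q \<in> D \<and> g q = s1) \<alpha> C1 K1 b \<and>
    (g x > s1 \<longrightarrow> C0 = {#}) \<and> K0 + K1 + total_mass (low C) powr \<alpha> * sav x \<le> K"
  using assms(5,6)
proof (induction rule: irrig.induct)
  case (empty x)
  show ?case
    by (intro exI[of _ "{#}"] exI[of _ 0]) (auto simp: low_def intro: irrig.empty forest.empty)
next
  case (leaf m x)
  show ?case
  proof (cases "g x \<le> s1")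
    case True
    then show ?thesis using leaf
      by (intro exI[of _ "{#(x, m)#}"] exI[of _ "{#}"] exI[of _ 0])
         (auto simp: low_def sav_def intro: irrig.leaf forest.empty)
  next
    case False
    then show ?thesis
      by (intro exI[of _ "{#}"] exI[of _ 0]) (auto simp: low_def intro: irrig.empty forest.empty)
  qed
next
  case (edge z C K x)
  note xz = A(1)[OF edge.hyps(2)] A(2)[OF edge.hyps(2)] A(3)[OF edge.hyps(2)] A(4)[OF edge.hyps(2)]
    A(5)[OF edge.hyps(2)]
  obtain C0 C1 K0 K1 b where IH: "low C = C0 + C1" "irr \<alpha> z C0 K0"
    "forest (\<lambda>q. q \<in> D \<and> g q = s1) \<alpha> C1 K1 b" "g z > s1 \<longrightarrow> C0 = {#}"
    "K0 + K1 + total_mass (low C) powr \<alpha> * sav z \<le> K"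
    using edge.IH[OF xz(1)] by blast
  have low_le: "total_mass (low C) \<le> total_mass C"
    unfolding low_def using irrig_weights[OF edge.hyps(1)] by (rule total_mass_filter_le)
  have m0: "total_mass C0 \<ge> 0" "total_mass C1 \<ge> 0"
    by (rule irrig_total_mass_nonneg[OF IH(2)], rule forest_total_mass_nonneg[OF IH(3)])
  show ?case
  proof (cases "g x \<le> s1 \<and> g z \<le> s1")
    case True
    have "total_mass C0 powr \<alpha> * dist x z \<le> total_mass C powr \<alpha> * len x z"
      using xz(4) True m0 low_le IH(1) \<alpha> by (intro mult_mono powr_mono2) auto
    moreover have "irr \<alpha> x C0 (K0 + total_mass C0 powr \<alpha> * dist x z)"
      using IH(2) by (rule irrig.edge) simp
    moreover have "sav x = 0" "sav z = 0" using True by (auto simp: sav_def)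
    ultimately show ?thesis using IH True
      by (intro exI[of _ C0] exI[of _ C1] exI[of _ "K0 + total_mass C0 powr \<alpha> * dist x z"]
          exI[of _ K1] exI[of _ b]) auto
  next
    case False
    \<comment> \<open>An edge above the level is dropped. Branches in \<open>C0\<close> survive only
      if \<open>z\<close> lies on the level, and then they become a tree of the forest.\<close>
    then have side: "g x \<ge> s1" "g z \<ge> s1" using xz(2) by (auto simp: same_side_def)
    have K0: "K0 \<ge> 0" using IH(2) by (rule irrig_cost_nonneg) simp
    have "\<exists>K' b'. forest (\<lambda>q. q \<in> D \<and> g q = s1) \<alpha> (low C) K' b' \<and> K' \<le> K0 + K1"
    proof (cases "g z = s1")
      case True
      then have "forest (\<lambda>q. q \<in> D \<and> g q = s1) \<alpha> C0 K0 (total_mass C0 powr \<alpha>)"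
        using IH(2) xz(1) by (intro forest_single) auto
      from forest_union[OF IH(3) this] show ?thesis by (auto simp: IH(1))
    next
      case False
      then have "C0 = {#}" using IH(4) side by simp
      then show ?thesis using IH(1,3) K0 by auto
    qed
    then obtain K' b' where F: "forest (\<lambda>q. q \<in> D \<and> g q = s1) \<alpha> (low C) K' b'" "K' \<le> K0 + K1" by auto
    \<comment> \<open>\<open>sav u\<close> measures the part of the slab from \<open>s1\<close> to
      \<open>s2\<close> that lies below \<open>u\<close>. The dropped edge carries all of the low
      mass, so its charge pays for the increase of \<open>sav\<close> from \<open>z\<close> to
      \<open>x\<close>.\<close>
    have "total_mass (low C) powr \<alpha> * sav x \<le> total_mass (low C) powr \<alpha> * (sav z + len x z)"
      using xz(5) by (intro mult_left_mono) auto
    also have "\<dots> \<le> total_mass (low C) powr \<alpha> * sav z + total_mass C powr \<alpha> * len x z"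
      using low_le m0 IH(1) \<alpha> xz(3) by (auto simp: distrib_left intro!: mult_right_mono powr_mono2)
    finally have "0 + K' + total_mass (low C) powr \<alpha> * sav x \<le> K + total_mass C powr \<alpha> * len x z"
      using IH(5) F(2) by simp
    then show ?thesis using F(1) irrig.empty[of dist _ \<alpha> x]
      by (intro exI[of _ "{#}"] exI[of _ "low C"] exI[of _ 0] exI[of _ K'] exI[of _ b']) simp
  qed
next
  case (join x C K C' K')
  obtain C0 C1 K0 K1 b where IH: "low C = C0 + C1" "irr \<alpha> x C0 K0"
    "forest (\<lambda>q. q \<in> D \<and> g q = s1) \<alpha> C1 K1 b" "g x > s1 \<longrightarrow> C0 = {#}"
    "K0 + K1 + total_mass (low C) powr \<alpha> * sav x \<le> K"
    using join.IH(1)[OF join.prems] by blast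
  obtain C0' C1' K0' K1' b' where IH': "low C' = C0' + C1'" "irr \<alpha> x C0' K0'"
    "forest (\<lambda>q. q \<in> D \<and> g q = s1) \<alpha> C1' K1' b'" "g x > s1 \<longrightarrow> C0' = {#}"
    "K0' + K1' + total_mass (low C') powr \<alpha> * sav x \<le> K'"
    using join.IH(2)[OF join.prems] by blast
  have m0: "total_mass (low C) \<ge> 0" "total_mass (low C') \<ge> 0"
    using irrig_weights[OF join.hyps(1)] irrig_weights[OF join.hyps(2)]
    by (auto simp: low_def intro!: total_mass_nonneg)
  have low_join: "low (C + C') = low C + low C'" by (simp add: low_def)
  \<comment> \<open>The saving for the joined mass is at most the sum of the separate savings, since
    powers are subadditive.\<close>
  have "total_mass (low C + low C') powr \<alpha> * sav x
      \<le> total_mass (low C) powr \<alpha> * sav x + total_mass (low C') powr \<alpha> * sav x"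
    using m0 by (intro powr_mass_subadditive_mult \<alpha>) (auto simp: sav_def)
  then have "(K0 + K0') + (K1' + K1) + total_mass (low (C + C')) powr \<alpha> * sav x \<le> K + K'"
    using IH(5) IH'(5) by (simp add: low_join)
  moreover have "low (C + C') = (C0 + C0') + (C1' + C1)" using IH(1) IH'(1) by (simp add: low_join)
  moreover have "g x > s1 \<longrightarrow> C0 + C0' = {#}" using IH(4) IH'(4) by simp
  ultimately show ?case using irrig.join[OF IH(2) IH'(2)] forest_union[OF IH(3) IH'(3)] by blast
next
  case (slack x C K K')
  then show ?case by (meson order_trans)
qed

text \<open>The part of \<open>C\<close> above level \<open>s\<close> stays connected to a root above \<open>s\<close>. A path that goes down to
  level \<open>t\<close> is cut: the roots in which it returns to level \<open>s\<close> are gathered at a point where it left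
  that level, and this is paid for by the discarded return from \<open>t\<close> to \<open>s\<close>.\<close>

lemma irrig_keep:
  fixes g :: "'a::metric_space \<Rightarrow> real" and s t :: real
  defines "high \<equiv> filter_mset (\<lambda>c. g (fst c) \<ge> s)"
  assumes \<alpha>: "0 \<le> \<alpha>" "\<alpha> \<le> 1" and "irrig len A \<alpha> x C K" "x \<in> D" "g x \<ge> t" and "t \<le> s" and "\<epsilon> > 0"
    and g: "\<And>x z. g z - g x \<le> dist x z"
    and A: "\<And>x z. A x z \<Longrightarrow> z \<in> D" "\<And>x z. A x z \<Longrightarrow> same_side g t x z" "\<And>x z. A x z \<Longrightarrow> same_side g s x z"
      "\<And>x z. A x z \<Longrightarrow> len x z \<ge> 0" "\<And>x z. A x z \<Longrightarrow> g x \<ge> t \<Longrightarrow> g z \<ge> t \<Longrightarrow> dist x z \<le> len x z"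
    and gather: "\<And>q C K b \<epsilon>. q \<in> D \<Longrightarrow> g q = s \<Longrightarrow> forest (\<lambda>q. q \<in> D \<and> g q = s) \<alpha> C K b \<Longrightarrow> \<epsilon> > 0 \<Longrightarrow>
      irr \<alpha> q C (K + total_mass C powr \<alpha> * (s - t) + \<epsilon>)"
  shows "\<exists>C0 C1 K0 K1 b. high C = C0 + C1 \<and> irr \<alpha> x C0 K0 \<and> forest (\<lambda>q. q \<in> D \<and> g q = s) \<alpha> C1 K1 b \<and>
    (g x \<ge> s \<longrightarrow> C1 = {#}) \<and> K0 + K1 + total_mass C1 powr \<alpha> * (s - t) \<le> K + \<epsilon>"
  using assms(4-6,8)
proof (induction arbitrary: \<epsilon> rule: irrig.induct)
  case (empty x)
  then show ?case
    by (intro exI[of _ "{#}"] exI[of _ 0]) (auto simp: high_def intro: irrig.empty forest.empty)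
next
  case (leaf m x)
  show ?case
  proof (cases "g x \<ge> s")
    case True
    then show ?thesis using leaf
      by (intro exI[of _ "{#(x, m)#}"] exI[of _ "{#}"] exI[of _ 0])
         (auto simp: high_def intro: irrig.leaf forest.empty)
  next
    case False
    then show ?thesis using leaf
      by (intro exI[of _ "{#}"] exI[of _ 0]) (auto simp: high_def intro: irrig.empty forest.empty)
  qed
next
  case (edge z C K x)
  note xz = A(1)[OF edge.hyps(2)] A(2)[OF edge.hyps(2)] A(3)[OF edge.hyps(2)] A(4)[OF edge.hyps(2)]
    A(5)[OF edge.hyps(2)]
  let ?K = "K + total_mass C powr \<alpha> * len x z"
  have half: "\<epsilon> / 2 > 0" using edge.prems(3) by simp
  \<comment> \<open>The situation before gathering: on level \<open>s\<close> itself
    \<open>C1\<close> may still be nonempty, and half of \<open>\<epsilon>\<close> is reserved for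
    gathering it.\<close>
  have pre: "\<exists>C0 C1 K0 K1 b. high C = C0 + C1 \<and> irr \<alpha> x C0 K0 \<and> forest (\<lambda>q. q \<in> D \<and> g q = s) \<alpha> C1 K1 b \<and>
      (g x > s \<longrightarrow> C1 = {#}) \<and>
      K0 + K1 + total_mass C1 powr \<alpha> * (s - t) \<le> ?K + \<epsilon> / 2"
  proof (cases "g x = t")
    case True
    \<comment> \<open>At level \<open>t\<close> the branch is cut by \<open>irrig_cut\<close> for
      the reflected function \<open>- g\<close>. If \<open>t < s\<close>, only trees rooted on level
      \<open>s\<close> remain, with a credit of \<open>s - t\<close> times the power of their
      mass.\<close>
    let ?sav = "\<lambda>u. max 0 (min (- g u) (- t) - - s)"
    have sav: "?sav x \<le> ?sav z + len x z" if "A x z" for x z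
      using A(2)[OF that] A(4)[OF that] A(5)[OF that] g[of z x] by (auto simp: same_side_def)
    have ss: "same_side (\<lambda>u. - g u) (- s) x z" if "A x z" for x z
      using A(3)[OF that] by (auto simp: same_side_def)
    have len_ge: "dist x z \<le> len x z" if "A x z" "- g x \<le> - s" "- g z \<le> - s" for x z
      using A(5)[OF that(1)] that \<open>t \<le> s\<close> by auto
    have "\<exists>C0 C1 K0 K1 b. filter_mset (\<lambda>c. - g (fst c) \<le> - s) C = C0 + C1 \<and> irr \<alpha> x C0 K0 \<and>
      forest (\<lambda>q. q \<in> D \<and> - g q = - s) \<alpha> C1 K1 b \<and> (- g x > - s \<longrightarrow> C0 = {#}) \<and>
      K0 + K1 + total_mass (filter_mset (\<lambda>c. - g (fst c) \<le> - s) C) powr \<alpha> * ?sav x \<le> ?K"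
      by (rule irrig_cut[OF \<alpha> irrig.edge[OF edge.hyps] edge.prems(1), where g = "\<lambda>u. - g u"])
        (fact A(1) ss A(4) len_ge sav)+
    then obtain C0 C1 K0 K1 b where cut: "high C = C0 + C1" "irr \<alpha> x C0 K0"
      "forest (\<lambda>q. q \<in> D \<and> g q = s) \<alpha> C1 K1 b"
      "K0 + K1 + total_mass (high C) powr \<alpha> * ?sav x \<le> ?K"
      unfolding high_def neg_le_iff_le neg_equal_iff_equal by blast
    have "total_mass C1 powr \<alpha> * (s - t) \<le> total_mass (high C) powr \<alpha> * (s - t)"
      using \<open>t \<le> s\<close> irrig_total_mass_nonneg[OF cut(2)] forest_total_mass_nonneg[OF cut(3)] \<alpha>
      by (intro mult_right_mono powr_mono2) (auto simp: cut(1))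
    moreover have "?sav x = s - t" using True \<open>t \<le> s\<close> by simp
    ultimately have "K0 + K1 + total_mass C1 powr \<alpha> * (s - t) \<le> ?K + \<epsilon> / 2"
      using cut(4) edge.prems(3) by simp
    then show ?thesis using cut(1,2,3) True \<open>t \<le> s\<close>
      by (intro exI[of _ C0] exI[of _ C1] exI[of _ K0] exI[of _ K1] exI[of _ b]) simp
  next
    case False
    then have side: "g x > t" "g z \<ge> t" using edge.prems(2) xz(2) by (auto simp: same_side_def)
    obtain C0 C1 K0 K1 b where IH: "high C = C0 + C1" "irr \<alpha> z C0 K0"
      "forest (\<lambda>q. q \<in> D \<and> g q = s) \<alpha> C1 K1 b" "g z \<ge> s \<longrightarrow> C1 = {#}"
      "K0 + K1 + total_mass C1 powr \<alpha> * (s - t) \<le> K + \<epsilon> / 2"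
      using edge.IH[OF xz(1) side(2) half] by blast
    have m0: "total_mass C0 \<ge> 0" "total_mass C1 \<ge> 0"
      by (rule irrig_total_mass_nonneg[OF IH(2)], rule forest_total_mass_nonneg[OF IH(3)])
    have "total_mass (high C) \<le> total_mass C"
      unfolding high_def using irrig_weights[OF edge.hyps(1)] by (rule total_mass_filter_le)
    then have "total_mass C0 powr \<alpha> * dist x z \<le> total_mass C powr \<alpha> * len x z"
      using xz(5) side m0 IH(1) \<alpha> by (intro mult_mono powr_mono2) auto
    moreover have "irr \<alpha> x C0 (K0 + total_mass C0 powr \<alpha> * dist x z)"
      using IH(2) by (rule irrig.edge) simp
    moreover have "g x > s \<longrightarrow> C1 = {#}" using xz(3) IH(4) by (auto simp: same_side_def)
    ultimately show ?thesis using IH(1,3,5)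
      by (intro exI[of _ C0] exI[of _ C1] exI[of _ "K0 + total_mass C0 powr \<alpha> * dist x z"]
          exI[of _ K1] exI[of _ b] conjI) (assumption | linarith)+
  qed
  then obtain C0 C1 K0 K1 b where pre: "high C = C0 + C1" "irr \<alpha> x C0 K0"
    "forest (\<lambda>q. q \<in> D \<and> g q = s) \<alpha> C1 K1 b" "g x > s \<longrightarrow> C1 = {#}"
    "K0 + K1 + total_mass C1 powr \<alpha> * (s - t) \<le> ?K + \<epsilon> / 2"
    by blast
  show ?case
  proof (cases "g x = s")
    case True
    \<comment> \<open>Up to \<open>\<epsilon> / 2\<close>, the credit collected from the returns is
      the price of gathering their roots at \<open>x\<close>.\<close>
    have "irr \<alpha> x C1 (K1 + total_mass C1 powr \<alpha> * (s - t) + \<epsilon> / 2)"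
      using gather[OF edge.prems(1) True pre(3), of "\<epsilon> / 2"] edge.prems(3) by simp
    from irrig.join[OF pre(2) this]
    have "irr \<alpha> x (high C) (K0 + (K1 + total_mass C1 powr \<alpha> * (s - t) + \<epsilon> / 2))" by (simp add: pre(1))
    then show ?thesis using pre(5) forest.empty[of "\<lambda>q. q \<in> D \<and> g q = s" \<alpha>]
      by (intro exI[of _ "high C"] exI[of _ "{#}"] 
        exI[of _ "K0 + (K1 + total_mass C1 powr \<alpha> * (s - t) + \<epsilon> / 2)"] exI[of _ 0]) simp
  next
    case False
    then have "g x \<ge> s \<longrightarrow> C1 = {#}" using pre(4) by auto
    moreover have "K0 + K1 + total_mass C1 powr \<alpha> * (s - t) \<le> ?K + \<epsilon>" using pre(5) edge.prems(3) by simp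
    ultimately show ?thesis using pre(1-3) by blast
  qed
next
  case (join x C K C' K')
  have half: "\<epsilon> / 2 > 0" using join.prems(3) by simp
  obtain C0 C1 K0 K1 b where IH: "high C = C0 + C1" "irr \<alpha> x C0 K0"
    "forest (\<lambda>q. q \<in> D \<and> g q = s) \<alpha> C1 K1 b" "g x \<ge> s \<longrightarrow> C1 = {#}"
    "K0 + K1 + total_mass C1 powr \<alpha> * (s - t) \<le> K + \<epsilon> / 2"
    using join.IH(1)[OF join.prems(1,2) half] by blast
  obtain C0' C1' K0' K1' b' where IH': "high C' = C0' + C1'" "irr \<alpha> x C0' K0'"
    "forest (\<lambda>q. q \<in> D \<and> g q = s) \<alpha> C1' K1' b'" "g x \<ge> s \<longrightarrow> C1' = {#}"
    "K0' + K1' + total_mass C1' powr \<alpha> * (s - t) \<le> K' + \<epsilon> / 2"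
    using join.IH(2)[OF join.prems(1,2) half] by blast
  have "total_mass (C1' + C1) powr \<alpha> * (s - t)
      \<le> total_mass C1' powr \<alpha> * (s - t) + total_mass C1 powr \<alpha> * (s - t)"
    using forest_total_mass_nonneg[OF IH(3)] forest_total_mass_nonneg[OF IH'(3)] \<open>t \<le> s\<close>
    by (intro powr_mass_subadditive_mult \<alpha>) auto
  then have "(K0 + K0') + (K1' + K1) + total_mass (C1' + C1) powr \<alpha> * (s - t) \<le> K + K' + \<epsilon>"
    using IH(5) IH'(5) by simp
  moreover have "high (C + C') = (C0 + C0') + (C1' + C1)" using IH(1) IH'(1) by (simp add: high_def)
  moreover have "g x \<ge> s \<longrightarrow> C1' + C1 = {#}" using IH(4) IH'(4) by simp
  ultimately show ?case using irrig.join[OF IH(2) IH'(2)] forest_union[OF IH(3) IH'(3)] by blast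
next
  case (slack x C K K')
  then show ?case by (meson order_trans add_right_mono)
qed

section \<open>The cylinder around the axis\<close>

definition cylinder :: "'a::real_inner \<Rightarrow> 'a \<Rightarrow> real \<Rightarrow> 'a set" where
  "cylinder p v R = {z. norm (z - p - axis_coord p v z *\<^sub>R v) \<le> R}"

lemma axis_coord_lipschitz:
  assumes "norm v = 1"
  shows "axis_coord p v z - axis_coord p v x \<le> dist x z"
proof -
  have "axis_coord p v z - axis_coord p v x = (z - x) \<bullet> v"
    by (simp add: axis_coord_def inner_diff_left)
  also have "\<dots> \<le> norm (z - x) * norm v" by (rule norm_cauchy_schwarz)
  finally show ?thesis using assms by (simp add: dist_norm norm_minus_commute)
qed

lemma convex_cylinder: "convex (cylinder p v R)"
proof (rule convexI)
  fix x y and u w :: real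
  assume *: "x \<in> cylinder p v R" "y \<in> cylinder p v R" "0 \<le> u" "0 \<le> w" "u + w = 1"
  have "u *\<^sub>R x + w *\<^sub>R y - p - axis_coord p v (u *\<^sub>R x + w *\<^sub>R y) *\<^sub>R v
      = u *\<^sub>R (x - p - axis_coord p v x *\<^sub>R v) + w *\<^sub>R (y - p - axis_coord p v y *\<^sub>R v)
        - (1 - (u + w)) *\<^sub>R (p - (p \<bullet> v) *\<^sub>R v)"
    by (simp add: axis_coord_def inner_diff_left inner_add_left algebra_simps)
  also have "\<dots> = u *\<^sub>R (x - p - axis_coord p v x *\<^sub>R v) + w *\<^sub>R (y - p - axis_coord p v y *\<^sub>R v)"
    using *(5) by simp
  also have "norm \<dots> \<le> u * norm (x - p - axis_coord p v x *\<^sub>R v) + w * norm (y - p - axis_coord p v y *\<^sub>R v)"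
    using * norm_triangle_ineq[of "u *\<^sub>R (x - p - axis_coord p v x *\<^sub>R v)" "w *\<^sub>R (y - p - axis_coord p v y *\<^sub>R v)"]
    by simp
  also have "\<dots> \<le> R" using * by (intro convex_bound_le) (auto simp: cylinder_def)
  finally show "u *\<^sub>R x + w *\<^sub>R y \<in> cylinder p v R" by (simp add: cylinder_def)
qed

lemma closed_cylinder: "closed (cylinder p v R)"
  unfolding cylinder_def axis_coord_def by (intro closed_Collect_le continuous_intros)

lemma dist_axis_le:
  assumes "q \<in> cylinder p v R" "norm v = 1"
  shows "dist q (p + t *\<^sub>R v) \<le> R + \<bar>t - axis_coord p v q\<bar>"
proof -
  have "q - (p + t *\<^sub>R v) = (q - p - axis_coord p v q *\<^sub>R v) + (axis_coord p v q - t) *\<^sub>R v"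
    by (simp add: algebra_simps)
  then have "norm (q - (p + t *\<^sub>R v)) \<le> norm (q - p - axis_coord p v q *\<^sub>R v) + norm ((axis_coord p v q - t) *\<^sub>R v)"
    by (metis norm_triangle_ineq)
  then show ?thesis using assms by (simp add: cylinder_def dist_norm)
qed

lemma gather_constant_ge_1:
  assumes "\<beta> > 0"
  shows "sqrt (real DIM('a::euclidean_space) - 1) / (2 powr \<beta> - 1) + 1 \<ge> 1"
proof -
  have "(2::real) powr \<beta> > 1" using assms by simp
  moreover have "real DIM('a) \<ge> 1" using DIM_positive[where 'a = 'a] by linarith
  ultimately show ?thesis by simp
qed

text \<open>The cross section is a ball of radius \<open>R\<close> in a hyperplane, hence contained
  in a cube of half side \<open>R\<close> with respect to any orthonormal basis of the complement of
  \<open>v\<close>; this is where the dimension drops by 1.\<close>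

lemma cylinder_gather:
  fixes p v :: "'a::euclidean_space"
  assumes \<alpha>: "0 \<le> \<alpha>" "\<alpha> \<le> 1" and v: "norm v = 1" and "R \<ge> 0" and "\<epsilon> > 0"
    and \<beta>: "\<beta> = 1 - (real DIM('a) - 1) * (1 - \<alpha>)" "\<beta> > 0"
    and F: "forest (\<lambda>q. q \<in> cylinder p v R \<and> axis_coord p v q = t) \<alpha> C K b"
  shows "irr \<alpha> (p + t *\<^sub>R v) C
    (K + sqrt (real DIM('a) - 1) / (2 powr \<beta> - 1) * R * total_mass C powr \<alpha> + \<epsilon>)"
proof -
  let ?H = "{u. v \<bullet> u = 0}"
  have "v \<noteq> 0" using v by auto
  then have dim: "dim ?H = DIM('a) - 1" by (rule dim_hyperplane)
  obtain B where B: "B \<subseteq> ?H" "pairwise orthogonal B" "\<And>x. x \<in> B \<Longrightarrow> norm x = 1"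
    "independent B" "card B = dim ?H" "span B = ?H"
    using orthonormal_basis_subspace[OF subspace_hyperplane[of v]] by metis
  have card: "real (card B) = real DIM('a) - 1"
    using B(5) dim DIM_positive[where 'a = 'a] by (simp add: of_nat_diff Suc_leI)
  have "forest (cube B (p + t *\<^sub>R v) R) \<alpha> C K b"
  proof (rule forest_mono[OF F])
    fix q assume q: "q \<in> cylinder p v R \<and> axis_coord p v q = t"
    have "v \<bullet> v = 1" using v by (simp add: norm_eq_1)
    then have "v \<bullet> (q - (p + t *\<^sub>R v)) = 0"
      using q by (simp add: axis_coord_def inner_diff_right inner_add_right inner_commute)
    moreover have "\<bar>(q - (p + t *\<^sub>R v)) \<bullet> b\<bar> \<le> R" if "b \<in> B" for b
    proof -
      have "\<bar>(q - (p + t *\<^sub>R v)) \<bullet> b\<bar> \<le> norm (q - (p + t *\<^sub>R v)) * norm b" by (rule Cauchy_Schwarz_ineq2)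
      also have "\<dots> \<le> R" using B(3)[OF that] dist_axis_le[of q p v R t] q v by (simp add: dist_norm)
      finally show ?thesis .
    qed
    ultimately show "cube B (p + t *\<^sub>R v) R q" by (simp add: cube_def B(6))
  qed
  moreover have "finite B" using B(4) by (rule independent_imp_finite)
  moreover have "\<beta> = 1 - real (card B) * (1 - \<alpha>)" using \<beta>(1) by (simp add: card)
  ultimately have "irr \<alpha> (p + t *\<^sub>R v) C
    (K + sqrt (real (card B)) / (2 powr \<beta> - 1) * R * total_mass C powr \<alpha> + \<epsilon>)"
    using B(2,3) \<beta>(2) \<open>R \<ge> 0\<close> \<open>\<epsilon> > 0\<close> by (intro forest_gather \<alpha>)
  then show ?thesis by (simp add: card)
qed

text \<open>The stretch of length \<open>CC * R\<close> of the gap next to \<open>t2\<close> pays for removing returning paths, the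
  rest of the gap is saved.\<close>

lemma irr_separate:
  fixes p v :: "'a::euclidean_space"
  assumes \<alpha>: "0 \<le> \<alpha>" "\<alpha> \<le> 1" and v: "norm v = 1" and R: "R \<ge> 0" and "\<epsilon> > 0" and "\<sigma> > 0"
    and \<beta>: "\<beta> = 1 - (real DIM('a) - 1) * (1 - \<alpha>)" "\<beta> > 0"
    and CC: "CC = sqrt (real DIM('a) - 1) / (2 powr \<beta> - 1) + 1"
    and t2: "t2 = t1 + 2 * CC * R + \<sigma>"
    and irr: "irr \<alpha> x C K" and x: "x \<in> cylinder p v R" "axis_coord p v x \<ge> t2"
    and C: "\<And>c. c \<in># C \<Longrightarrow> fst c \<in> cylinder p v R"
  defines "low \<equiv> filter_mset (\<lambda>c. axis_coord p v (fst c) \<le> t1) C"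
    and "high \<equiv> filter_mset (\<lambda>c. axis_coord p v (fst c) \<ge> t2) C"
  shows "\<exists>K1 K2. irr \<alpha> x high K1 \<and> irr \<alpha> (p + t1 *\<^sub>R v) low K2 \<and>
    K1 + K2 + total_mass low powr \<alpha> * (\<sigma> + R) \<le> K + \<epsilon>"
proof -
  let ?g = "axis_coord p v"
  let ?D = "cylinder p v R"
  define T where "T = t2 - CC * R"
  have CC1: "CC \<ge> 1" unfolding CC using \<beta>(2) by (rule gather_constant_ge_1)
  then have CCR: "CC * R \<ge> 0" using R by simp
  have T: "t1 < T" "T \<le> t2" "T - t1 = CC * R + \<sigma>" "t2 - T = CC * R"
    using CCR \<open>\<sigma> > 0\<close> by (auto simp: T_def t2 algebra_simps)
  have D: "closed ?D" "convex ?D" "?D \<noteq> {}"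
    using closed_cylinder convex_cylinder x(1) by auto
  define A where "A = (\<lambda>x z. x \<in> ?D \<and> z \<in> ?D \<and> (\<forall>t\<in>{t1, T, t2}. same_side ?g t x z))"
  have "irrig dist (\<lambda>x z. x \<in> ?D \<and> z \<in> ?D) \<alpha> (closest_point ?D x) C K"
    using irr C D by (intro irrig_project)
      (auto intro: closest_point_in_set closest_point_self closest_point_lipschitz)
  then have "irrig dist (\<lambda>x z. x \<in> ?D \<and> z \<in> ?D) \<alpha> x C K" using x(1) by (simp add: closest_point_self)
  then have irrA: "irrig dist A \<alpha> x C K"
    unfolding A_def by (intro irrig_subdivide_levels D) auto
  \<comment> \<open>Edges within level \<open>T\<close> are left to \<open>len2\<close>, so that no
    length is charged twice.\<close>
  define len1 where "len1 = (\<lambda>x z. if ?g x \<le> T \<and> ?g z \<le> T \<and> \<not> (?g x \<ge> T \<and> ?g z \<ge> T) then dist x z else 0)"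
  define len2 where "len2 = (\<lambda>x z. if ?g x \<ge> T \<and> ?g z \<ge> T then dist x z else 0)"
  have "len1 x z + len2 x z \<le> dist x z" for x z by (auto simp: len1_def len2_def)
  then obtain Ka Kb where K: "irrig len1 A \<alpha> x C Ka" "irrig len2 A \<alpha> x C Kb" "Ka + Kb \<le> K"
    using irrig_split_length[OF irrA, of len1 len2] by blast
  have lip: "?g z - ?g x \<le> dist x z" for x z using v by (rule axis_coord_lipschitz)
  have A_dest: "z \<in> ?D" "same_side ?g t1 x z" "same_side ?g T x z" "same_side ?g t2 x z" if "A x z" for x z
    using that by (auto simp: A_def)
  have half: "\<epsilon> / 2 > 0" using \<open>\<epsilon> > 0\<close> by simp

  have "\<exists>C0 C1 K0 K1 b. low = C0 + C1 \<and> irr \<alpha> x C0 K0 \<and> forest (\<lambda>q. q \<in> ?D \<and> ?g q = t1) \<alpha> C1 K1 b \<and>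
    (?g x > t1 \<longrightarrow> C0 = {#}) \<and> K0 + K1 + total_mass low powr \<alpha> * max 0 (min (?g x) T - t1) \<le> Ka"
    unfolding low_def
  proof (rule irrig_cut[OF \<alpha> K(1) x(1)])
    fix x z assume "A x z"
    note a = A_dest[OF this]
    show "z \<in> ?D" "same_side ?g t1 x z" by fact+
    show "len1 x z \<ge> 0" by (simp add: len1_def)
    show "dist x z \<le> len1 x z" if "?g x \<le> t1" "?g z \<le> t1" using that T(1) by (simp add: len1_def)
    show "max 0 (min (?g x) T - t1) \<le> max 0 (min (?g z) T - t1) + len1 x z"
      using a(3) lip[of x z] zero_le_dist[of x z] T(1) by (auto simp: len1_def same_side_def dist_commute)
  qed
  moreover have "?g x > t1" using x(2) T by simp
  moreover have "max 0 (min (?g x) T - t1) = CC * R + \<sigma>" using x(2) T CCR \<open>\<sigma> > 0\<close> by simp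
  ultimately obtain K0 K1 b where cut: "irr \<alpha> x {#} K0" "forest (\<lambda>q. q \<in> ?D \<and> ?g q = t1) \<alpha> low K1 b"
    "K0 + K1 + total_mass low powr \<alpha> * (CC * R + \<sigma>) \<le> Ka" by auto
  \<comment> \<open>Gathering on the axis uses \<open>(CC - 1) * R\<close> of the saved length
    \<open>CC * R + \<sigma>\<close> and leaves \<open>\<sigma> + R\<close>.\<close>
  have irr_low: "irr \<alpha> (p + t1 *\<^sub>R v) low (K1 + (CC - 1) * R * total_mass low powr \<alpha> + \<epsilon> / 2)"
    using cylinder_gather[OF \<alpha> v R half \<beta> cut(2)] by (simp add: CC)
  have "\<exists>C0 C1 K0 K1 b. high = C0 + C1 \<and> irr \<alpha> x C0 K0 \<and>
    forest (\<lambda>q. q \<in> ?D \<and> ?g q = t2) \<alpha> C1 K1 b \<and>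
    (?g x \<ge> t2 \<longrightarrow> C1 = {#}) \<and> K0 + K1 + total_mass C1 powr \<alpha> * (t2 - T) \<le> Kb + \<epsilon> / 2"
    unfolding high_def
  proof (rule irrig_keep[OF \<alpha> K(2) x(1) _ T(2) half lip])
    show "?g x \<ge> T" using x(2) T(2) by simp
    fix x z assume "A x z"
    note a = A_dest[OF this]
    show "z \<in> ?D" "same_side ?g T x z" "same_side ?g t2 x z" by fact+
    show "len2 x z \<ge> 0" by (simp add: len2_def)
    show "dist x z \<le> len2 x z" if "?g x \<ge> T" "?g z \<ge> T" using that by (simp add: len2_def)
  next
    fix q C K b and \<epsilon> :: real
    assume q: "q \<in> ?D" "?g q = t2" and F: "forest (\<lambda>q. q \<in> ?D \<and> ?g q = t2) \<alpha> C K b" and "\<epsilon> > 0"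
    have "irr \<alpha> (p + t2 *\<^sub>R v) C (K + (CC - 1) * R * total_mass C powr \<alpha> + \<epsilon>)"
      using cylinder_gather[OF \<alpha> v R \<open>\<epsilon> > 0\<close> \<beta> F] by (simp add: CC)
    then have "irr \<alpha> q C (K + (CC - 1) * R * total_mass C powr \<alpha> + \<epsilon>
        + total_mass C powr \<alpha> * dist q (p + t2 *\<^sub>R v))"
      by (rule irrig.edge) simp
    \<comment> \<open>The radius from \<open>q\<close> to the axis raises the factor
      \<open>CC - 1\<close> to \<open>CC\<close>, matching \<open>t2 - T = CC * R\<close>.\<close>
    moreover have "total_mass C powr \<alpha> * dist q (p + t2 *\<^sub>R v) \<le> total_mass C powr \<alpha> * R"
      using dist_axis_le[OF q(1) v, of t2] q(2) by (intro mult_left_mono) auto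
    ultimately show "irr \<alpha> q C (K + total_mass C powr \<alpha> * (t2 - T) + \<epsilon>)"
      unfolding T(4) by (elim irrig.slack) (simp add: algebra_simps)
  qed
  then obtain K0' K1' b' where keep: "irr \<alpha> x high K0'" "forest (\<lambda>q. q \<in> ?D \<and> ?g q = t2) \<alpha> {#} K1' b'"
    "K0' + K1' \<le> Kb + \<epsilon> / 2" using x(2) by auto
  have "K0 \<ge> 0" using cut(1) by (rule irrig_cost_nonneg) simp
  moreover have "K1' \<ge> 0" using keep(2) by (rule forest_cost_nonneg)
  ultimately have "K0' + (K1 + (CC - 1) * R * total_mass low powr \<alpha> + \<epsilon> / 2)
      + total_mass low powr \<alpha> * (\<sigma> + R) \<le> K + \<epsilon>"
    using cut(3) keep(3) K(3) by (simp add: algebra_simps)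
  then show ?thesis using keep(1) irr_low by blast
qed

section \<open>Reassigning targets\<close>

definition target_points :: "(nat \<Rightarrow> 'a) \<Rightarrow> (nat \<Rightarrow> real) \<Rightarrow> nat set \<Rightarrow> ('a \<times> real) multiset" where
  "target_points y n J = image_mset (\<lambda>j. (y j, n j)) (mset_set J)"

lemma to_measure_target_points:
  "finite J \<Longrightarrow> to_measure (target_points y n J) = (\<Sum>j\<in>J. Poly_Mapping.single (y j) (n j))"
  by (induction J rule: finite_induct) (auto simp: target_points_def)

lemma total_mass_target_points: "finite J \<Longrightarrow> total_mass (target_points y n J) = (\<Sum>j\<in>J. n j)"
  by (induction J rule: finite_induct) (auto simp: target_points_def)

lemma target_points_Un:
  "finite J \<Longrightarrow> finite J' \<Longrightarrow> J \<inter> J' = {} \<Longrightarrow>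
    target_points y n (J \<union> J') = target_points y n J + target_points y n J'"
  by (simp add: target_points_def mset_set_Union)

lemma filter_target_points:
  "finite J \<Longrightarrow> filter_mset (\<lambda>c. P (fst c)) (target_points y n J) = target_points y n {j\<in>J. P (y j)}"
  by (simp add: target_points_def filter_mset_image_mset)

lemma E_cost_target_points:
  "E_cost \<alpha> l k x n y S = (\<Sum>i=1..k. d_cost \<alpha>
    (Poly_Mapping.single (x i) (total_mass (target_points y n {j\<in>{1..l}. S j = i})))
    (to_measure (target_points y n {j\<in>{1..l}. S j = i})))"
  by (simp add: E_cost_def source_part_def target_part_def to_measure_target_points total_mass_target_points)

lemma optimal_assignment_no_crossing:
  fixes x y :: "nat \<Rightarrow> 'a::euclidean_space" and p v :: 'a
  assumes \<alpha>: "0 \<le> \<alpha>" "\<alpha> \<le> 1" and v: "norm v = 1" and R: "R \<ge> 0" and \<sigma>: "\<sigma> > 0"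
    and \<beta>: "\<beta> = 1 - (real DIM('a) - 1) * (1 - \<alpha>)" "\<beta> > 0"
    and CC: "CC = sqrt (real DIM('a) - 1) / (2 powr \<beta> - 1) + 1"
    and t2: "t2 = t1 + 2 * CC * R + \<sigma>"
    and n: "\<And>j. j \<in> {1..l} \<Longrightarrow> n j > 0"
    and x: "x ` {1..k} \<subseteq> cylinder p v R" and y: "y ` {1..l} \<subseteq> cylinder p v R"
    and gap: "axis_coord p v ` (y ` {1..l}) \<inter> {t1<..<t2} = {}"
    and i': "i' \<in> {1..k}" "axis_coord p v (x i') \<in> {t1 - \<sigma><..t1}"
    and S: "optimal_assignment \<alpha> l k x n y S"
    and j: "j \<in> {1..l}" "axis_coord p v (y j) \<le> t1" "axis_coord p v (x (S j)) \<ge> t2"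
  shows False
proof -
  let ?g = "axis_coord p v"
  have Smap: "S \<in> {1..l} \<rightarrow>\<^sub>E {1..k}" using S by (simp add: optimal_assignment_def assignment_maps_def)
  have "CC \<ge> 1" unfolding CC using \<beta>(2) by (rule gather_constant_ge_1)
  then have "CC * R \<ge> 0" using R by simp
  then have t12: "t1 < t2" using \<sigma> by (simp add: t2)
  define i where "i = S j"
  have i: "i \<in> {1..k}" "i \<noteq> i'" using Smap j i'(2) t12 by (auto simp: i_def)
  define J where "J = (\<lambda>i. {j\<in>{1..l}. S j = i})"
  \<comment> \<open>All low targets of source \<open>i\<close> are moved together, because the
    saving is governed by the power of their joint mass.\<close>
  define L where "L = {j\<in>J i. ?g (y j) \<le> t1}"
  define T where "T = (\<lambda>j. if j \<in> L then i' else S j)"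
  have finJ: "finite (J i)" for i by (simp add: J_def)
  have finL: "finite L" by (simp add: L_def finJ)
  have L_sub: "L \<subseteq> {1..l}" by (auto simp: L_def J_def)
  have Tmap: "T \<in> assignment_maps l k"
    using Smap L_sub i'(1) by (auto simp: assignment_maps_def T_def PiE_iff extensional_def)
  define d where "d = (\<lambda>i J. d_cost \<alpha> (Poly_Mapping.single (x i) (total_mass (target_points y n J)))
    (to_measure (target_points y n J)))"
  have weights: "snd c > 0" if "c \<in># target_points y n (J h)" for c h
    using that n finJ by (auto simp: target_points_def J_def)
  \<comment> \<open>Targets avoid the gap, so those that stay with \<open>i\<close> are exactly its
    targets beyond the gap.\<close>
  have "{j\<in>{1..l}. T j = i} = {j\<in>J i. ?g (y j) \<ge> t2}"
  proof -
    have "\<not> ?g (y j') \<le> t1 \<longleftrightarrow> ?g (y j') \<ge> t2" if "j' \<in> {1..l}" for j'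
    proof -
      have "?g (y j') \<notin> {t1<..<t2}" using gap that by blast
      then show ?thesis using t12 by auto
    qed
    then show ?thesis using i(2) by (auto simp: T_def L_def J_def)
  qed
  moreover have "{j\<in>{1..l}. T j = i'} = J i' \<union> L"
    using i(2) L_sub by (auto simp: T_def J_def L_def)
  moreover have "{j\<in>{1..l}. T j = i''} = J i''" if "i'' \<noteq> i" "i'' \<noteq> i'" for i''
    using that by (auto simp: T_def J_def L_def)
  ultimately have JT: "(\<Sum>i''=1..k. d i'' {j\<in>{1..l}. T j = i''}) - (\<Sum>i''=1..k. d i'' (J i''))
     = (d i {j\<in>J i. ?g (y j) \<ge> t2} - d i (J i)) + (d i' (J i' \<union> L) - d i' (J i'))"
  proof -
    have "(\<Sum>i''=1..k. d i'' {j\<in>{1..l}. T j = i''}) - (\<Sum>i''=1..k. d i'' (J i''))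
      = (\<Sum>i''=1..k. d i'' {j\<in>{1..l}. T j = i''} - d i'' (J i''))" by (simp add: sum_subtractf)
    also have "\<dots> = (\<Sum>i''\<in>{i, i'}. d i'' {j\<in>{1..l}. T j = i''} - d i'' (J i''))"
      using i(1) i'(1) \<open>\<And>i''. i'' \<noteq> i \<Longrightarrow> i'' \<noteq> i' \<Longrightarrow> {j\<in>{1..l}. T j = i''} = J i''\<close>
      by (intro sum.mono_neutral_right) auto
    finally show ?thesis
      using i(2) \<open>{j\<in>{1..l}. T j = i} = {j\<in>J i. ?g (y j) \<ge> t2}\<close> \<open>{j\<in>{1..l}. T j = i'} = J i' \<union> L\<close>
      by simp
  qed
  have "E_cost \<alpha> l k x n y S \<le> E_cost \<alpha> l k x n y T"
    using S Tmap by (simp add: optimal_assignment_def)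
  then have opt: "d i (J i) + d i' (J i') \<le> d i {j\<in>J i. ?g (y j) \<ge> t2} + d i' (J i' \<union> L)"
    using JT by (simp add: E_cost_target_points d_def J_def)

  define m where "m = total_mass (target_points y n L) powr \<alpha>"
  have "(\<Sum>j\<in>L. n j) > 0"
    using finL L_sub n j by (intro sum_pos) (auto simp: L_def J_def i_def)
  then have m: "m > 0" by (simp add: m_def total_mass_target_points finL)
  \<comment> \<open>The surplus: the saving \<open>m * (\<sigma> + R)\<close> minus the bound
    \<open>m * (R + (t1 - ?g (x i')))\<close> for reaching the axis at \<open>t1\<close>. Three
    errors of \<open>\<delta> / 4\<close>, from two infima and the separation, stay below
    it.\<close>
  define \<delta> where "\<delta> = m * (\<sigma> - (t1 - ?g (x i')))"
  have \<delta>: "\<delta> / 4 > 0" using m i'(2) by (simp add: \<delta>_def)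
  have approx: "\<exists>K < d h (J h) + \<delta> / 4. irr \<alpha> (x h) (target_points y n (J h)) K" for h
    unfolding d_def by (rule d_cost_approx[OF \<alpha> _ \<delta>]) (rule weights)
  obtain K where K: "irr \<alpha> (x i) (target_points y n (J i)) K" "K < d i (J i) + \<delta> / 4"
    using approx by blast
  obtain K' where K': "irr \<alpha> (x i') (target_points y n (J i')) K'" "K' < d i' (J i') + \<delta> / 4"
    using approx by blast
  have cyl: "fst c \<in> cylinder p v R" if "c \<in># target_points y n (J i)" for c
    using that y finJ by (auto simp: target_points_def J_def)
  have xi: "x i \<in> cylinder p v R" "?g (x i) \<ge> t2" using x i(1) j(3) by (auto simp: i_def)
  have xi': "x i' \<in> cylinder p v R" using x i'(1) by blast
  obtain K1 K2 where sep: "irr \<alpha> (x i) (target_points y n {j\<in>J i. ?g (y j) \<ge> t2}) K1"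
    "irr \<alpha> (p + t1 *\<^sub>R v) (target_points y n L) K2" "K1 + K2 + m * (\<sigma> + R) \<le> K + \<delta> / 4"
    using irr_separate[OF \<alpha> v R \<delta> \<sigma> \<beta> CC t2 K(1) xi cyl]
    by (auto simp: filter_target_points[OF finJ, of "\<lambda>z. ?g z \<le> t1"]
      filter_target_points[OF finJ, of "\<lambda>z. ?g z \<ge> t2"] L_def[symmetric] m_def[symmetric])
  have "irr \<alpha> (x i') (target_points y n L) (K2 + m * dist (x i') (p + t1 *\<^sub>R v))"
    unfolding m_def using sep(2) by (rule irrig.edge) simp
  from irrig.join[OF K'(1) this]
  have "irr \<alpha> (x i') (target_points y n (J i' \<union> L)) (K' + (K2 + m * dist (x i') (p + t1 *\<^sub>R v)))"
    using finJ finL i(2) by (subst target_points_Un) (auto simp: L_def J_def)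
  then have "d i' (J i' \<union> L) \<le> K' + (K2 + m * dist (x i') (p + t1 *\<^sub>R v))"
    unfolding d_def by (rule d_cost_le[OF \<alpha>])
  moreover have "d i {j\<in>J i. ?g (y j) \<ge> t2} \<le> K1"
    unfolding d_def using sep(1) by (rule d_cost_le[OF \<alpha>])
  moreover have "m * dist (x i') (p + t1 *\<^sub>R v) \<le> m * (R + (t1 - ?g (x i')))"
    using dist_axis_le[OF xi' v, of t1] i'(2) m by (intro mult_left_mono) auto
  moreover have "m * (R + (t1 - ?g (x i'))) = m * (\<sigma> + R) - \<delta>" by (simp add: \<delta>_def algebra_simps)
  ultimately show False using opt K(2) K'(2) sep(3) \<delta> by linarith
qed

lemma axis_coord_uminus: "axis_coord p (- v) z = - axis_coord p v z"
  by (simp add: axis_coord_def)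

lemma cylinder_uminus: "cylinder p (- v) R = cylinder p v R"
  by (simp add: cylinder_def axis_coord_uminus)

theorem corollary5p2:
  fixes X :: "(real ^ 'm) set"
    and x y :: "nat \<Rightarrow> real ^ 'm"
    and n :: "nat \<Rightarrow> real"
    and k l :: nat
    and p v :: "real ^ 'm"
    and \<alpha> \<sigma> t1 t2 C R :: real
  assumes "0 \<le> \<alpha>" and "\<alpha> < 1"
    and C_meaningful: "1 - (real CARD('m) - 1) * (1 - \<alpha>) > 0"
    and "compact X" and "convex X"
    and "inj_on x {1..k}" and "x ` {1..k} \<subseteq> X"
    and "y ` {1..l} \<subseteq> X"
    and "\<And>j. j \<in> {1..l} \<Longrightarrow> n j > 0" and "(\<Sum>j=1..l. n j) = 1"
    and "norm v = 1"
    and C: "C = sqrt (real CARD('m) - 1)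
                / (2 powr (1 - (real CARD('m) - 1) * (1 - \<alpha>)) - 1) + 1"
    and R: "R = Max ((\<lambda>z. norm (z - p - axis_coord p v z *\<^sub>R v)) ` (y ` {1..l} \<union> x ` {1..k}))"
    and "\<sigma> > 0" and "t2 = t1 + 2 * C * R + \<sigma>"
    and "axis_coord p v ` (x ` {1..k} \<union> y ` {1..l}) \<inter> {t1<..<t2} = {}"
    and "axis_coord p v ` (x ` {1..k}) \<inter> {t1 - \<sigma><..t1} \<noteq> {}"
    and "axis_coord p v ` (x ` {1..k}) \<inter> {t2..<t2 + \<sigma>} \<noteq> {}"
  shows "\<forall>S. optimal_assignment \<alpha> l k x n y S \<longrightarrow>
           (\<forall>I\<in>{{..t1}, {t2..}}. \<forall>j\<in>{1..l}.
              axis_coord p v (y j) \<in> I \<longleftrightarrow> axis_coord p v (x (S j)) \<in> I)"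
proof (intro allI impI)
  fix S assume S: "optimal_assignment \<alpha> l k x n y S"
  let ?g = "axis_coord p v"
  let ?\<beta> = "1 - (real DIM(real ^ 'm) - 1) * (1 - \<alpha>)"
  have dim: "DIM(real ^ 'm) = CARD('m)" by simp
  have \<alpha>: "0 \<le> \<alpha>" "\<alpha> \<le> 1" and \<beta>: "?\<beta> > 0"
    and CC: "C = sqrt (real DIM(real ^ 'm) - 1) / (2 powr ?\<beta> - 1) + 1"
    using assms(1-3) C unfolding dim by auto
  have Smap: "S \<in> {1..l} \<rightarrow>\<^sub>E {1..k}" using S by (simp add: optimal_assignment_def assignment_maps_def)
  obtain a where a: "a \<in> {1..k}" "?g (x a) \<in> {t1 - \<sigma><..t1}" using assms(17) by blast
  obtain b where b: "b \<in> {1..k}" "?g (x b) \<in> {t2..<t2 + \<sigma>}" using assms(18) by blast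
  have le_R: "norm (z - p - ?g z *\<^sub>R v) \<le> R" if "z \<in> y ` {1..l} \<union> x ` {1..k}" for z
    unfolding R using that by (intro Max_ge) auto
  then have xy: "x ` {1..k} \<subseteq> cylinder p v R" "y ` {1..l} \<subseteq> cylinder p v R" by (auto simp: cylinder_def)
  have R0: "R \<ge> 0" using le_R[of "x a"] a(1) norm_ge_zero order_trans by blast
  have "C \<ge> 1" unfolding CC using \<beta> by (rule gather_constant_ge_1)
  then have "C * R \<ge> 0" using R0 by simp
  then have t12: "t1 < t2" using assms(14,15) by simp
  have gap: "?g (x i) \<le> t1 \<or> ?g (x i) \<ge> t2" if "i \<in> {1..k}" for i
    using that assms(16) by (force simp: disjoint_iff not_less)
  have gap': "?g (y j) \<le> t1 \<or> ?g (y j) \<ge> t2" if "j \<in> {1..l}" for j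
    using that assms(16) by (force simp: disjoint_iff not_less)
  have fwd: False if "j \<in> {1..l}" "?g (y j) \<le> t1" "?g (x (S j)) \<ge> t2" for j
    using assms(16) by (intro optimal_assignment_no_crossing[OF \<alpha> assms(11) R0 assms(14) refl \<beta> CC
      assms(15,9) xy _ a S that]) auto
  \<comment> \<open>Reversing the axis turns the gap into the interval from \<open>- t2\<close> to
    \<open>- t1\<close> and makes \<open>x b\<close> a source just before it.\<close>
  have bwd: False if j: "j \<in> {1..l}" "?g (y j) \<ge> t2" "?g (x (S j)) \<le> t1" for j
  proof (rule optimal_assignment_no_crossing[OF \<alpha> _ R0 assms(14) refl \<beta> CC _ assms(9) _ _ _ b(1) _ S j(1)])
    show "norm (- v) = 1" using assms(11) by simp
    show "- t1 = - t2 + 2 * C * R + \<sigma>" using assms(15) by simp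
    show "x ` {1..k} \<subseteq> cylinder p (- v) R" "y ` {1..l} \<subseteq> cylinder p (- v) R"
      using xy by (simp_all add: cylinder_uminus)
    show "axis_coord p (- v) ` (y ` {1..l}) \<inter> {- t2<..<- t1} = {}"
      using gap' by (force simp: axis_coord_uminus)
    show "axis_coord p (- v) (x b) \<in> {- t2 - \<sigma><..- t2}" using b(2) by (simp add: axis_coord_uminus)
    show "axis_coord p (- v) (y j) \<le> - t2" "- t1 \<le> axis_coord p (- v) (x (S j))"
      using j by (simp_all add: axis_coord_uminus)
  qed
  show "\<forall>I\<in>{{..t1}, {t2..}}. \<forall>j\<in>{1..l}. ?g (y j) \<in> I \<longleftrightarrow> ?g (x (S j)) \<in> I"
  proof (intro ballI)
    fix I j assume I: "I \<in> {{..t1}, {t2..}}" and j: "j \<in> {1..l}"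
    have "S j \<in> {1..k}" using Smap j by auto
    then have "?g (y j) \<le> t1 \<and> ?g (x (S j)) \<le> t1 \<or> ?g (y j) \<ge> t2 \<and> ?g (x (S j)) \<ge> t2"
      using gap gap' j fwd bwd by blast
    then show "?g (y j) \<in> I \<longleftrightarrow> ?g (x (S j)) \<in> I" using I t12 by auto
  qed
qed

end
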